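(* There exist universal constants $c,C>0$ such that the following holds. Let $m,n\ge1$ be integers and $G,R,\epsilon>0$ with $\max\{m,n\}>(GR/\epsilon)^2>1$. Let $\mathcal{X}_{\rm op}(R):=\{W\in\mathbb{R}^{m\times n}:\|W\|_{\rm op}\le R\}$, and let $\mathcal{F}_{\rm op}(G,R)$ be the class of functions $f:\mathbb{R}^{m\times n}\to\mathbb{R}$ that are convex and $G$-Lipschitz with respect to $\|\cdot\|_{\rm op}$ on an open set containing $\mathcal{X}_{\rm op}(R)$. Then for every local first-order oracle $\mathsf{O}$ on $\mathcal{F}_{\rm op}(G,R)$, $$c\,\min\{m,n\}\left(\tfrac{GR}{\epsilon}\right)^2\le\mathfrak{m}_{\rm dc}(\mathcal{X}_{\rm op}(R),\mathcal{F}_{\rm op}(G,R),\mathsf{O},\epsilon)\le\mathfrak{m}_{\rm wcc}(\mathcal{X}_{\rm op}(R),\mathcal{F}_{\rm op}(G,R),\mathsf{O},\epsilon)\le C\,\min\{m,n\}\left(\tfrac{GR}{\epsilon}\right)^2.$$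
   Context: $\|\cdot\|_{\rm op}$ is the operator (spectral) norm on $\mathbb{R}^{m\times n}$; subdifferentials are with respect to the Frobenius inner product. Oracle model. Let $\mathcal{F}$ be a class of convex functions $\mathbb{R}^{m\times n}\to\mathbb{R}$ and $\mathcal{X}\subseteq\mathbb{R}^{m\times n}$ nonempty, compact and convex. A first-order oracle on $\mathcal{F}$ is a map $\mathsf{O}:\mathcal{F}\times\mathbb{R}^{m\times n}\to\mathbb{R}\times\mathbb{R}^{m\times n}$ with $\mathsf{O}_f(W)=(f(W),g)$ for some $g\in\partial f(W)$. It is local if $\mathsf{O}_{f_1}(W)=\mathsf{O}_{f_2}(W)$ whenever $f_1,f_2\in\mathcal{F}$ agree on a neighborhood of $W$. $\mathcal{A}(\mathsf{O})$ is the set of deterministic algorithms based on $\mathsf{O}$: such an algorithm maintains the transcript $\Pi_q=((X^1,\mathsf{O}_f(X^1)),\dots,(X^q,\mathsf{O}_f(X^q)))$, $\Pi_0=\emptyset$, and applies a decision rule to the transcript that either stops and outputs a point $\widehat X\in\mathbb{R}^{m\times n}$ or selects the next query $X^{q+1}\in\mathbb{R}^{m\times n}$ (queries and outputs may lie anywhere in $\mathbb{R}^{m\times n}$). For $\mathsf{A}\in\mathcal{A}(\mathsf{O})$, $f\in\mathcal{F}$ and $\epsilon>0$, $\mathsf{T}_{\mathsf{A}}(f,\epsilon)=q$ if $\mathsf{A}$ run on $f$ stops after $q$ oracle calls with an output satisfying $f(\widehat X)-\min_{X\in\mathcal{X}}f(X)\le\epsilon$, and $\mathsf{T}_{\mathsf{A}}(f,\epsilon)=+\infty$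 otherwise. The worst-case and distributional complexities are $$\mathfrak{m}_{\rm wcc}(\mathcal{X},\mathcal{F},\mathsf{O},\epsilon):=\inf_{\mathsf{A}\in\mathcal{A}(\mathsf{O})}\sup_{f\in\mathcal{F}}\mathsf{T}_{\mathsf{A}}(f,\epsilon),\qquad \mathfrak{m}_{\rm dc}(\mathcal{X},\mathcal{F},\mathsf{O},\epsilon):=\sup_{\mathcal{P}\in\Delta(\mathcal{F})}\inf_{\mathsf{A}\in\mathcal{A}(\mathsf{O})}\mathbb{E}_{f\sim\mathcal{P}}[\mathsf{T}_{\mathsf{A}}(f,\epsilon)],$$ where $\Delta(\mathcal{F})$ is the set of probability distributions on $\mathcal{F}$. *)

theory Defs
  imports "HOL-Probability.Probability" "Jordan_Normal_Form.Matrix"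
begin

text \<open>
  The constants of the theorem are uniform in the dimensions, so the dimensions have to be
  natural numbers and not types: \<open>\<real>\<^sup>m\<^sup>\<times>\<^sup>n\<close> is \<^term>\<open>carrier_mat m n :: real mat set\<close>.
\<close>

section \<open>Geometry of real matrices\<close>

definition frob_inner :: "real mat \<Rightarrow> real mat \<Rightarrow> real" where
  "frob_inner A B = (\<Sum>i<dim_row A. \<Sum>j<dim_col A. A $$ (i, j) * B $$ (i, j))"

definition op_norm :: "real mat \<Rightarrow> real" where
  "op_norm A = (SUP x\<in>{x \<in> carrier_vec (dim_col A). sqrt (scalar_prod x x) \<le> 1}.
                  sqrt (scalar_prod (A *\<^sub>v x) (A *\<^sub>v x)))"

text \<open>
  The usual topology on \<open>\<real>\<^sup>m\<^sup>\<times>\<^sup>n\<close>, given by the Frobenius distance.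
\<close>

definition frob_dist :: "nat \<Rightarrow> nat \<Rightarrow> real mat \<Rightarrow> real mat \<Rightarrow> real" where
  "frob_dist m n A B = L2_set (\<lambda>ij. A $$ ij - B $$ ij) ({..<m} \<times> {..<n})"

definition mat_topology :: "nat \<Rightarrow> nat \<Rightarrow> real mat topology" where
  "mat_topology m n = Metric_space.mtopology (carrier_mat m n) (frob_dist m n)"

lemma Metric_space_frob_dist: "Metric_space (carrier_mat m n) (frob_dist m n)"
proof
  fix A B C :: "real mat"
  show "0 \<le> frob_dist m n A B"
    by (simp add: frob_dist_def)
  show "frob_dist m n A B = frob_dist m n B A"
    by (simp add: frob_dist_def L2_set_def power2_commute)
  show "frob_dist m n A B = 0 \<longleftrightarrow> A = B" if "A \<in> carrier_mat m n" "B \<in> carrier_mat m n"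
    using that by (auto simp: frob_dist_def L2_set_eq_0_iff)
  show "frob_dist m n A C \<le> frob_dist m n A B + frob_dist m n B C"
    using L2_set_triangle_ineq[of "\<lambda>ij. A $$ ij - B $$ ij" "\<lambda>ij. B $$ ij - C $$ ij"
        "{..<m} \<times> {..<n}"]
    by (simp add: frob_dist_def)
qed

definition convex_fun :: "nat \<Rightarrow> nat \<Rightarrow> (real mat \<Rightarrow> real) \<Rightarrow> bool" where
  "convex_fun m n f \<longleftrightarrow>
     (\<forall>V\<in>carrier_mat m n. \<forall>W\<in>carrier_mat m n. \<forall>t\<in>{0..1}.
        f ((1 - t) \<cdot>\<^sub>m V + t \<cdot>\<^sub>m W) \<le> (1 - t) * f V + t * f W)"

definition op_lipschitz_on :: "real \<Rightarrow> real mat set \<Rightarrow> (real mat \<Rightarrow> real) \<Rightarrow> bool" where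
  "op_lipschitz_on G U f \<longleftrightarrow> (\<forall>V\<in>U. \<forall>W\<in>U. \<bar>f V - f W\<bar> \<le> G * op_norm (V - W))"

definition subdifferential :: "nat \<Rightarrow> nat \<Rightarrow> (real mat \<Rightarrow> real) \<Rightarrow> real mat \<Rightarrow> real mat set" where
  "subdifferential m n f W =
     {g \<in> carrier_mat m n. \<forall>V\<in>carrier_mat m n. f V \<ge> f W + frob_inner g (V - W)}"

definition op_ball :: "nat \<Rightarrow> nat \<Rightarrow> real \<Rightarrow> real mat set" where
  "op_ball m n R = {W \<in> carrier_mat m n. op_norm W \<le> R}"

text \<open>
  Membership in \<^term>\<open>extensional (carrier_mat m n)\<close> makes the elements correspond one-to-one to
  functions on \<open>\<real>\<^sup>m\<^sup>\<times>\<^sup>n\<close>. Convexity is required on the whole space, the Lipschitz condition only on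
  an open neighbourhood, depending on \<open>f\<close>, of the ball.
\<close>

definition op_class :: "nat \<Rightarrow> nat \<Rightarrow> real \<Rightarrow> real \<Rightarrow> (real mat \<Rightarrow> real) set" where
  "op_class m n G R =
     {f \<in> extensional (carrier_mat m n). convex_fun m n f \<and>
        (\<exists>U. openin (mat_topology m n) U \<and> op_ball m n R \<subseteq> U \<and> op_lipschitz_on G U f)}"

section \<open>Oracles, algorithms and complexities\<close>

type_synonym oracle_map = "(real mat \<Rightarrow> real) \<Rightarrow> real mat \<Rightarrow> real \<times> real mat"

definition first_order_oracle :: "nat \<Rightarrow> nat \<Rightarrow> (real mat \<Rightarrow> real) set \<Rightarrow> oracle_map \<Rightarrow> bool" where
  "first_order_oracle m n F orc \<longleftrightarrow>
     (\<forall>f\<in>F. \<forall>W\<in>carrier_mat m n. \<exists>g\<in>subdifferential m n f W. orc f W = (f W, g))"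

definition local_oracle :: "nat \<Rightarrow> nat \<Rightarrow> (real mat \<Rightarrow> real) set \<Rightarrow> oracle_map \<Rightarrow> bool" where
  "local_oracle m n F orc \<longleftrightarrow>
     (\<forall>f1\<in>F. \<forall>f2\<in>F. \<forall>W\<in>carrier_mat m n.
        (\<exists>U. openin (mat_topology m n) U \<and> W \<in> U \<and> (\<forall>V\<in>U. f1 V = f2 V)) \<longrightarrow> orc f1 W = orc f2 W)"

datatype decision = Stop (point: "real mat") | Query (point: "real mat")

type_synonym transcript = "(real mat \<times> real \<times> real mat) list"

type_synonym algorithm = "transcript \<Rightarrow> decision"

definition algorithms :: "nat \<Rightarrow> nat \<Rightarrow> algorithm set" where
  "algorithms m n = {A. \<forall>p. point (A p) \<in> carrier_mat m n}"

text \<open>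
  \<open>reached orc A f p\<close>: the transcript \<open>p\<close> (oldest query first) occurs when \<open>A\<close> is run on \<open>f\<close>.
\<close>

inductive reached :: "oracle_map \<Rightarrow> algorithm \<Rightarrow> (real mat \<Rightarrow> real) \<Rightarrow> transcript \<Rightarrow> bool"
  for orc A f where
  start: "reached orc A f []"
| query: "reached orc A f p \<Longrightarrow> A p = Query X \<Longrightarrow> reached orc A f (p @ [(X, orc f X)])"

lemma reached_nth:
  assumes "reached orc A f p" "i < length p"
  shows "\<exists>X. A (take i p) = Query X \<and> p ! i = (X, orc f X)"
  using assms by induction (auto simp: nth_append less_Suc_eq)

lemma reached_Stop_unique:
  assumes p: "reached orc A f p" "A p = Stop X" and q: "reached orc A f q" "A q = Stop Y"
  shows "p = q"
proof -
  have eq: "take i p = take i q" if "i \<le> length p" "i \<le> length q" for i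
    using that
  proof (induction i)
    case (Suc i)
    then have "p ! i = q ! i"
      using reached_nth[OF p(1), of i] reached_nth[OF q(1), of i] by auto
    with Suc show ?case by (simp add: take_Suc_conv_app_nth)
  qed simp
  have "\<not> length p < length q"
    using eq[of "length p"] reached_nth[OF q(1), of "length p"] p(2) by auto
  moreover have "\<not> length q < length p"
    using eq[of "length q"] reached_nth[OF p(1), of "length q"] q(2) by auto
  ultimately show ?thesis
    using eq[of "length p"] by simp
qed

text \<open>
  A run reaches at most one transcript at which \<open>A\<close> stops, so the outer infimum is over at most
  one number of calls, and it is \<open>\<infinity>\<close> if there is none. The inner infimum is a minimum
  whenever \<open>f\<close> is convex and \<open>\<X>\<close> is nonempty and compact.
\<close>

definition oracle_calls ::
  "real mat set \<Rightarrow> oracle_map \<Rightarrow> algorithm \<Rightarrow> (real mat \<Rightarrow> real) \<Rightarrow> real \<Rightarrow> ennreal" where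
  "oracle_calls \<X> orc A f \<epsilon> =
     Inf {of_nat (length p) | p X.
            reached orc A f p \<and> A p = Stop X \<and> f X - (INF Y\<in>\<X>. f Y) \<le> \<epsilon>}"

definition wcc ::
  "nat \<Rightarrow> nat \<Rightarrow> real mat set \<Rightarrow> (real mat \<Rightarrow> real) set \<Rightarrow> oracle_map \<Rightarrow> real \<Rightarrow> ennreal" where
  "wcc m n \<X> F orc \<epsilon> = (INF A\<in>algorithms m n. SUP f\<in>F. oracle_calls \<X> orc A f \<epsilon>)"

text \<open>
  A probability distribution on \<open>F\<close> is a probability measure on an arbitrary \<open>\<sigma>\<close>-algebra of subsets
  of \<open>F\<close>, so discrete distributions are included. For a non-measurable integrand (oracles are
  arbitrary) \<^const>\<open>nn_integral\<close> is the lower integral, which is the smallest reading of the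
  expectation.
\<close>

definition distributions_on :: "(real mat \<Rightarrow> real) set \<Rightarrow> (real mat \<Rightarrow> real) measure set" where
  "distributions_on F = {P. prob_space P \<and> space P = F}"

definition dc ::
  "nat \<Rightarrow> nat \<Rightarrow> real mat set \<Rightarrow> (real mat \<Rightarrow> real) set \<Rightarrow> oracle_map \<Rightarrow> real \<Rightarrow> ennreal" where
  "dc m n \<X> F orc \<epsilon> =
     (SUP P\<in>distributions_on F. INF A\<in>algorithms m n. \<integral>\<^sup>+ f. oracle_calls \<X> orc A f \<epsilon> \<partial>P)"

end

theory Submission
  imports Defs
begin

text \<open>
  \<^bold>\<open>Upper bound.\<close> On the operator-norm ball of radius \<open>R\<close> the Frobenius norm is at most
  \<open>sqrt (min m n) * R\<close> and subgradients have Frobenius norm at most \<open>G\<close>, so the projected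
  subgradient method needs \<open>O(min m n * (G R / \<epsilon>)\<^sup>2)\<close> steps. Projections only up to a small error
  suffice, which avoids compactness.

  \<^bold>\<open>Lower bound.\<close> Take \<open>f(W) = max\<^sub>e (G \<xi>\<^sub>e W\<^sub>e - \<delta> s\<^sub>e)\<close> over a set \<open>I\<close> of entries, with hidden
  random signs \<open>\<xi>\<^sub>e\<close> and hidden random tiny shifts \<open>s\<^sub>e\<close>. Call \<open>e\<close> processed by a query \<open>X\<close> if
  \<open>G \<bar>X\<^sub>e\<bar> - \<delta> s\<^sub>e \<ge> f(X)\<close>: near \<open>X\<close> the function \<open>f\<close> does not depend on the unprocessed pieces, so a
  local oracle reveals nothing about them. When a piece is first processed, its sign agrees or
  disagrees with the sign of \<open>X\<^sub>e\<close>. An agreement makes the piece active at \<open>X\<close>, so unless two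
  pieces tie there is at most one agreement per query, and the random shifts make ties unlikely.
  The set of agreements and the shifts together determine the instance, hence at most
  \<open>\<Sum>\<^sub>k\<^sub>\<le>\<^sub>Q (|I| choose k)\<close> of the \<open>2\<^bsup>|I|\<^esup>\<close> sign patterns can be solved with \<open>Q\<close> queries, because a
  solution makes all pieces negative and thus processes all of them. It remains to choose \<open>I\<close>
  with about \<open>min m n * (G R / \<epsilon>)\<^sup>2\<close> entries such that sufficiently many sign patterns on \<open>I\<close> have
  operator norm below \<open>G R / \<epsilon>\<close>, so that \<open>min f < - \<epsilon>\<close>. Diagonal blocks of random signs do this.
\<close>

section \<open>The operator norm\<close>

lemma L2_set_mult_le: "(\<Sum>i\<in>A. f i * g i) \<le> L2_set f A * L2_set g A"
proof -
  have "(\<Sum>i\<in>A. f i * g i) \<le> (\<Sum>i\<in>A. \<bar>f i\<bar> * \<bar>g i\<bar>)"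
    by (intro sum_mono) (simp add: abs_mult[symmetric])
  then show ?thesis
    using L2_set_mult_ineq order_trans by blast
qed

lemma L2_set_power2: "(L2_set f A)\<^sup>2 = (\<Sum>i\<in>A. (f i)\<^sup>2)"
  by (simp add: L2_set_def sum_nonneg)

lemma L2_set_indicator:
  "finite A \<Longrightarrow> a \<in> A \<Longrightarrow> L2_set (\<lambda>i. if i = a then c else 0) A = \<bar>c\<bar>"
  by (simp add: L2_set_def if_distrib[of power2] if_distrib[of "\<lambda>x. x ^ 2"] cong: if_cong)

text \<open>Vector norms become \<open>L2_set\<close> of plain functions here, so that every later
  estimate is about finite sums of reals.\<close>

lemma op_norm_conv_SUP:
  assumes "A \<in> carrier_mat m n"
  shows "op_norm A = (SUP x\<in>{x \<in> carrier_vec n. L2_set (vec_index x) {..<n} \<le> 1}.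
           L2_set (\<lambda>i. \<Sum>j<n. A $$ (i, j) * vec_index x j) {..<m})"
proof -
  have self: "sqrt (scalar_prod v v) = L2_set (vec_index v) {..<k}" if "v \<in> carrier_vec k" for v k
    using that by (simp add: scalar_prod_def L2_set_def power2_eq_square lessThan_atLeast0)
  have mult: "sqrt (scalar_prod (A *\<^sub>v x) (A *\<^sub>v x)) =
      L2_set (\<lambda>i. \<Sum>j<n. A $$ (i, j) * vec_index x j) {..<m}" if "x \<in> carrier_vec n" for x
    using assms that
    by (simp add: self[of _ m])
       (intro L2_set_cong, simp_all add: scalar_prod_def lessThan_atLeast0)
  have "{x \<in> carrier_vec (dim_col A). sqrt (scalar_prod x x) \<le> 1}
      = {x \<in> carrier_vec n. L2_set (vec_index x) {..<n} \<le> 1}"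
    using assms by (intro Collect_cong conj_cong) (auto simp only: self carrier_matD)
  then show ?thesis
    unfolding op_norm_def by (intro SUP_cong) (auto simp only: mult)
qed

lemma mult_vec_le_Frobenius:
  fixes A :: "real mat" and x :: "nat \<Rightarrow> real"
  shows
  "L2_set (\<lambda>i. \<Sum>j<n. A $$ (i, j) * x j) {..<m}
     \<le> L2_set (\<lambda>ij. A $$ ij) ({..<m} \<times> {..<n}) * L2_set x {..<n}"
proof (rule power2_le_imp_le)
  have "(L2_set (\<lambda>i. \<Sum>j<n. A $$ (i, j) * x j) {..<m})\<^sup>2 = (\<Sum>i<m. (\<Sum>j<n. A $$ (i, j) * x j)\<^sup>2)"
    by (rule L2_set_power2)
  also have "\<dots> \<le> (\<Sum>i<m. (\<Sum>j<n. (A $$ (i, j))\<^sup>2) * (\<Sum>j<n. (x j)\<^sup>2))"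
    by (intro sum_mono Cauchy_Schwarz_ineq_sum)
  also have "\<dots> = (L2_set (\<lambda>ij. A $$ ij) ({..<m} \<times> {..<n}) * L2_set x {..<n})\<^sup>2"
    by (simp add: power_mult_distrib L2_set_power2 sum_distrib_right sum.cartesian_product
      case_prod_unfold)
  finally show "(L2_set (\<lambda>i. \<Sum>j<n. A $$ (i, j) * x j) {..<m})\<^sup>2
     \<le> (L2_set (\<lambda>ij. A $$ ij) ({..<m} \<times> {..<n}) * L2_set x {..<n})\<^sup>2" .
qed simp

lemma op_norm_bdd_above:
  "bdd_above ((\<lambda>x. L2_set (\<lambda>i. \<Sum>j<n. A $$ (i, j) * vec_index x j) {..<m}) `
     {x \<in> carrier_vec n. L2_set (vec_index x) {..<n} \<le> 1})"
proof (rule bdd_aboveI2)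
  fix x assume "x \<in> {x \<in> carrier_vec n. L2_set (vec_index x) {..<n} \<le> 1}"
  then have "L2_set (\<lambda>ij. A $$ ij) ({..<m} \<times> {..<n}) * L2_set (vec_index x) {..<n}
      \<le> L2_set (\<lambda>ij. A $$ ij) ({..<m} \<times> {..<n}) * 1"
    by (intro mult_left_mono) auto
  then show "L2_set (\<lambda>i. \<Sum>j<n. A $$ (i, j) * vec_index x j) {..<m}
      \<le> L2_set (\<lambda>ij. A $$ ij) ({..<m} \<times> {..<n})"
    using mult_vec_le_Frobenius[where A = A and x = "vec_index x" and m = m and n = n] by simp
qed

text \<open>With \<open>bilinear_le_op_norm\<close> this characterises the operator norm by its
  bilinear form. Testing with the image vector \<open>A x\<close> on the left turns the assumption
  into \<open>|A x|^2 \<le> c |A x| |x|\<close>.\<close>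

lemma op_norm_leI:
  assumes A: "A \<in> carrier_mat m n" and "0 \<le> c"
    and le: "\<And>x y. (\<Sum>i<m. \<Sum>j<n. A $$ (i, j) * x i * y j) \<le> c * L2_set x {..<m} * L2_set y {..<n}"
  shows "op_norm A \<le> c"
  unfolding op_norm_conv_SUP[OF A]
proof (rule cSUP_least)
  have "0\<^sub>v n \<in> {x \<in> carrier_vec n. L2_set (vec_index x) {..<n} \<le> (1::real)}"
    by (simp add: L2_set_def)
  then show "{x \<in> carrier_vec n. L2_set (vec_index x) {..<n} \<le> (1::real)} \<noteq> {}"
    by blast
  fix x assume x: "x \<in> {x \<in> carrier_vec n. L2_set (vec_index x) {..<n} \<le> (1::real)}"
  define v where "v = (\<lambda>i. \<Sum>j<n. A $$ (i, j) * vec_index x j)"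
  have "(v i)\<^sup>2 = (\<Sum>j<n. A $$ (i, j) * v i * vec_index x j)" for i
    by (subst power2_eq_square, subst (2) v_def) (simp add: sum_distrib_left mult_ac)
  then have "(L2_set v {..<m})\<^sup>2 = (\<Sum>i<m. \<Sum>j<n. A $$ (i, j) * v i * vec_index x j)"
    by (simp add: L2_set_power2)
  also have "\<dots> \<le> c * L2_set v {..<m} * L2_set (vec_index x) {..<n}"
    by (rule le)
  also have "\<dots> \<le> c * L2_set v {..<m} * 1"
    using x \<open>0 \<le> c\<close> by (intro mult_left_mono) auto
  finally have "L2_set v {..<m} * L2_set v {..<m} \<le> c * L2_set v {..<m}"
    by (simp add: power2_eq_square)
  then have "L2_set v {..<m} \<le> c"
    using \<open>0 \<le> c\<close> L2_set_nonneg[of v "{..<m}"] by (cases "L2_set v {..<m} = 0") auto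
  then show "L2_set (\<lambda>i. \<Sum>j<n. A $$ (i, j) * vec_index x j) {..<m} \<le> c"
    by (simp add: v_def)
qed

lemma op_norm_nonneg:
  assumes A: "A \<in> carrier_mat m n"
  shows "0 \<le> op_norm A"
proof -
  have "L2_set (\<lambda>i. \<Sum>j<n. A $$ (i, j) * vec_index (0\<^sub>v n) j) {..<m} \<le> op_norm A"
    unfolding op_norm_conv_SUP[OF A]
    by (rule cSUP_upper[OF _ op_norm_bdd_above]) (simp add: L2_set_def)
  then show ?thesis
    using L2_set_nonneg order_trans by blast
qed

lemma mult_vec_le_op_norm:
  assumes A: "A \<in> carrier_mat m n"
  shows "L2_set (\<lambda>i. \<Sum>j<n. A $$ (i, j) * y j) {..<m} \<le> op_norm A * L2_set y {..<n}"
proof (cases "L2_set y {..<n} = 0")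
  case True
  then have "\<forall>j<n. y j = 0" by (simp add: L2_set_eq_0_iff)
  then show ?thesis by (simp add: L2_set_def)
next
  case False
  define r where "r = L2_set y {..<n}"
  have r: "r > 0" using False L2_set_nonneg[of y "{..<n}"] by (simp add: r_def less_le)
  define x where "x = vec n (\<lambda>j. y j / r)"
  have "L2_set (vec_index x) {..<n} = L2_set (\<lambda>j. y j * (1 / r)) {..<n}"
    by (intro L2_set_cong) (auto simp: x_def)
  also have "\<dots> = r * (1 / r)"
    using r L2_set_left_distrib[of "1 / r" y "{..<n}"] by (simp add: r_def)
  finally have x: "L2_set (vec_index x) {..<n} = 1"
    using r by simp
  have "L2_set (\<lambda>i. \<Sum>j<n. A $$ (i, j) * vec_index x j) {..<m} \<le> op_norm A"
    unfolding op_norm_conv_SUP[OF A]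
    by (rule cSUP_upper[OF _ op_norm_bdd_above]) (use x in \<open>simp add: x_def\<close>)
  moreover have "L2_set (\<lambda>i. \<Sum>j<n. A $$ (i, j) * vec_index x j) {..<m}
      = L2_set (\<lambda>i. (\<Sum>j<n. A $$ (i, j) * y j) * (1 / r)) {..<m}"
    by (intro L2_set_cong) (auto simp: x_def sum_divide_distrib)
  moreover have "\<dots> = L2_set (\<lambda>i. \<Sum>j<n. A $$ (i, j) * y j) {..<m} * (1 / r)"
    using r by (intro L2_set_left_distrib[symmetric]) simp
  ultimately show ?thesis
    using r by (simp add: field_simps r_def)
qed

lemma bilinear_le_op_norm:
  assumes A: "A \<in> carrier_mat m n"
  shows "(\<Sum>i<m. \<Sum>j<n. A $$ (i, j) * x i * y j) \<le> op_norm A * L2_set x {..<m} * L2_set y {..<n}"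
proof -
  have "(\<Sum>i<m. \<Sum>j<n. A $$ (i, j) * x i * y j) = (\<Sum>i<m. x i * (\<Sum>j<n. A $$ (i, j) * y j))"
    by (simp add: sum_distrib_left mult_ac)
  also have "\<dots> \<le> L2_set x {..<m} * L2_set (\<lambda>i. \<Sum>j<n. A $$ (i, j) * y j) {..<m}"
    by (rule L2_set_mult_le)
  also have "\<dots> \<le> L2_set x {..<m} * (op_norm A * L2_set y {..<n})"
    by (intro mult_left_mono mult_vec_le_op_norm A) simp
  finally show ?thesis by (simp add: mult_ac)
qed

section \<open>Comparison with entries, rows, columns and the Frobenius norm\<close>

lemma sum_sum_single:
  fixes g :: "nat \<Rightarrow> nat \<Rightarrow> real"
  assumes "i0 < m" "j0 < n" "\<And>i j. (i, j) \<noteq> (i0, j0) \<Longrightarrow> g i j = 0"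
  shows "(\<Sum>i<m. \<Sum>j<n. g i j) = g i0 j0"
proof -
  have "(\<Sum>j<n. g i j) = (if i = i0 then g i0 j0 else 0)" for i
    using assms by (cases "i = i0") (auto intro!: sum.neutral sum.remove[THEN trans] simp: sum.remove[of "{..<n}" j0])
  then show ?thesis using assms by simp
qed

text \<open>Signed unit vectors as test vectors. This makes functions of one entry Lipschitz for the
  operator norm, which the hard instances rely on.\<close>

lemma abs_entry_le_op_norm:
  assumes A: "A \<in> carrier_mat m n" and "i < m" "j < n"
  shows "\<bar>A $$ (i, j)\<bar> \<le> op_norm A"
proof -
  define c where "c = sgn (A $$ (i, j))"
  have c: "A $$ (i, j) * c = \<bar>A $$ (i, j)\<bar>" "\<bar>c\<bar> \<le> 1"
    by (simp_all add: c_def abs_sgn sgn_if)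
  have "\<bar>A $$ (i, j)\<bar> = (\<Sum>i'<m. \<Sum>j'<n. A $$ (i', j') * (if i' = i then c else 0) * (if j' = j then 1 else 0))"
    using assms c by (subst sum_sum_single[of i m j n]) auto
  also have "\<dots> \<le> op_norm A * L2_set (\<lambda>i'. if i' = i then c else 0) {..<m}
      * L2_set (\<lambda>j'. if j' = j then 1 else 0) {..<n}"
    by (rule bilinear_le_op_norm[OF A])
  also have "\<dots> = op_norm A * \<bar>c\<bar>"
    using assms by (simp add: L2_set_indicator)
  also have "\<dots> \<le> op_norm A"
    using c op_norm_nonneg[OF A] by (simp add: mult_left_le)
  finally show ?thesis .
qed

lemma op_norm_le_Frobenius:
  assumes A: "A \<in> carrier_mat m n"
  shows "op_norm A \<le> L2_set (\<lambda>ij. A $$ ij) ({..<m} \<times> {..<n})"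
proof (rule op_norm_leI[OF A])
  fix x y :: "nat \<Rightarrow> real"
  have "(\<Sum>i<m. \<Sum>j<n. A $$ (i, j) * x i * y j) = (\<Sum>i<m. x i * (\<Sum>j<n. A $$ (i, j) * y j))"
    by (simp add: sum_distrib_left mult_ac)
  also have "\<dots> \<le> L2_set x {..<m} * L2_set (\<lambda>i. \<Sum>j<n. A $$ (i, j) * y j) {..<m}"
    by (rule L2_set_mult_le)
  also have "\<dots> \<le> L2_set x {..<m} * (L2_set (\<lambda>ij. A $$ ij) ({..<m} \<times> {..<n}) * L2_set y {..<n})"
    by (intro mult_left_mono mult_vec_le_Frobenius) simp
  finally show "(\<Sum>i<m. \<Sum>j<n. A $$ (i, j) * x i * y j)
      \<le> L2_set (\<lambda>ij. A $$ ij) ({..<m} \<times> {..<n}) * L2_set x {..<m} * L2_set y {..<n}"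
    by (simp add: mult_ac)
qed simp

lemma column_le_op_norm:
  assumes A: "A \<in> carrier_mat m n" and "j < n"
  shows "L2_set (\<lambda>i. A $$ (i, j)) {..<m} \<le> op_norm A"
proof -
  have "(\<Sum>j'<n. A $$ (i, j') * (if j' = j then 1 else 0)) = A $$ (i, j)" for i
    using assms by (simp add: if_distrib cong: if_cong)
  then show ?thesis
    using mult_vec_le_op_norm[OF A, of "\<lambda>j'. if j' = j then 1 else 0"] assms
    by (simp add: L2_set_indicator)
qed

text \<open>The test vectors are a unit vector on the left and the row itself on the right.\<close>

lemma row_le_op_norm:
  assumes A: "A \<in> carrier_mat m n" and "i < m"
  shows "L2_set (\<lambda>j. A $$ (i, j)) {..<n} \<le> op_norm A"
proof -
  let ?r = "L2_set (\<lambda>j. A $$ (i, j)) {..<n}"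
  have "(\<Sum>i'<m. \<Sum>j<n. A $$ (i', j) * (if i' = i then 1 else 0) * A $$ (i, j))
      = (\<Sum>i'<m. if i' = i then (\<Sum>j<n. A $$ (i, j) * A $$ (i, j)) else 0)"
    by (intro sum.cong) auto
  then have "?r\<^sup>2 = (\<Sum>i'<m. \<Sum>j<n. A $$ (i', j) * (if i' = i then 1 else 0) * A $$ (i, j))"
    unfolding L2_set_power2 using assms by (simp add: power2_eq_square)
  also have "\<dots> \<le> op_norm A * L2_set (\<lambda>i'. if i' = i then 1 else 0) {..<m} * ?r"
    by (rule bilinear_le_op_norm[OF A])
  finally have "?r * ?r \<le> op_norm A * ?r"
    using assms by (simp add: L2_set_indicator power2_eq_square)
  then show ?thesis
    using op_norm_nonneg[OF A] L2_set_nonneg[of "\<lambda>j. A $$ (i, j)" "{..<n}"]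
    by (cases "?r = 0") auto
qed

text \<open>Source of the factor \<open>min m n\<close>: the squares are summed along the shorter
  side, each row or column contributing at most \<open>(op_norm A)\<^sup>2\<close>.\<close>

lemma Frobenius_le_op_norm:
  assumes A: "A \<in> carrier_mat m n"
  shows "(\<Sum>i<m. \<Sum>j<n. (A $$ (i, j))\<^sup>2) \<le> real (min m n) * (op_norm A)\<^sup>2"
proof (cases "m \<le> n")
  case True
  have "(\<Sum>j<n. (A $$ (i, j))\<^sup>2) \<le> (op_norm A)\<^sup>2" if "i < m" for i
    unfolding L2_set_power2[symmetric, of "\<lambda>j. A $$ (i, j)"]
    by (intro power_mono row_le_op_norm[OF A that]) simp
  then have "(\<Sum>i<m. \<Sum>j<n. (A $$ (i, j))\<^sup>2) \<le> (\<Sum>i<m. (op_norm A)\<^sup>2)"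
    by (intro sum_mono) simp
  with True show ?thesis by simp
next
  case False
  have col: "(\<Sum>i<m. (A $$ (i, j))\<^sup>2) \<le> (op_norm A)\<^sup>2" if "j < n" for j
    unfolding L2_set_power2[symmetric, of "\<lambda>i. A $$ (i, j)"]
    by (intro power_mono column_le_op_norm[OF A that]) simp
  have "(\<Sum>i<m. \<Sum>j<n. (A $$ (i, j))\<^sup>2) = (\<Sum>j<n. \<Sum>i<m. (A $$ (i, j))\<^sup>2)"
    by (rule sum.swap)
  also have "\<dots> \<le> (\<Sum>j<n. (op_norm A)\<^sup>2)"
    by (intro sum_mono) (simp add: col)
  finally show ?thesis using False by simp
qed

lemma op_ball_convex:
  assumes V: "V \<in> op_ball m n R" and W: "W \<in> op_ball m n R" and t: "0 \<le> t" "t \<le> 1"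
  shows "(1 - t) \<cdot>\<^sub>m V + t \<cdot>\<^sub>m W \<in> op_ball m n R"
proof -
  have c: "V \<in> carrier_mat m n" "W \<in> carrier_mat m n" "op_norm V \<le> R" "op_norm W \<le> R"
    using V W by (auto simp: op_ball_def)
  have "op_norm ((1 - t) \<cdot>\<^sub>m V + t \<cdot>\<^sub>m W) \<le> R"
  proof (rule op_norm_leI)
    show "0 \<le> R" using op_norm_nonneg[OF c(1)] c by simp
    fix x y
    let ?L = "L2_set x {..<m} * L2_set y {..<n}"
    have b: "(\<Sum>i<m. \<Sum>j<n. U $$ (i, j) * x i * y j) \<le> R * ?L"
      if "U \<in> carrier_mat m n" "op_norm U \<le> R" for U
    proof -
      have "op_norm U * ?L \<le> R * ?L"
        using that by (intro mult_right_mono) auto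
      with bilinear_le_op_norm[OF that(1), of x y] show ?thesis by (simp add: mult_ac)
    qed
    have "(\<Sum>i<m. \<Sum>j<n. ((1 - t) \<cdot>\<^sub>m V + t \<cdot>\<^sub>m W) $$ (i, j) * x i * y j)
        = (1 - t) * (\<Sum>i<m. \<Sum>j<n. V $$ (i, j) * x i * y j) + t * (\<Sum>i<m. \<Sum>j<n. W $$ (i, j) * x i * y j)"
      unfolding sum_distrib_left sum.distrib[symmetric]
      using c by (intro sum.cong refl) (simp add: algebra_simps)
    also have "\<dots> \<le> (1 - t) * (R * ?L) + t * (R * ?L)"
      using t c by (intro add_mono mult_left_mono b) auto
    finally show "(\<Sum>i<m. \<Sum>j<n. ((1 - t) \<cdot>\<^sub>m V + t \<cdot>\<^sub>m W) $$ (i, j) * x i * y j)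
      \<le> R * L2_set x {..<m} * L2_set y {..<n}"
      by (simp add: algebra_simps)
  qed (use c in simp)
  with c show ?thesis by (simp add: op_ball_def)
qed

lemma zero_in_op_ball: "0 \<le> R \<Longrightarrow> 0\<^sub>m m n \<in> op_ball m n R"
  by (auto simp: op_ball_def intro!: op_norm_leI)

section \<open>The subgradient method with approximate projections\<close>

lemma frob_inner_carrier:
  "A \<in> carrier_mat m n \<Longrightarrow> frob_inner A B = (\<Sum>i<m. \<Sum>j<n. A $$ (i, j) * B $$ (i, j))"
  by (auto simp: frob_inner_def)

lemma frob_inner_minus:
  "C \<in> carrier_mat m n \<Longrightarrow>
    frob_inner (A - C) B = (\<Sum>i<m. \<Sum>j<n. (A $$ (i, j) - C $$ (i, j)) * B $$ (i, j))"
  by (auto simp: frob_inner_def)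

lemma frob_inner_self:
  assumes "A \<in> carrier_mat m n"
  shows "frob_inner A A = (L2_set (\<lambda>ij. A $$ ij) ({..<m} \<times> {..<n}))\<^sup>2"
  unfolding L2_set_power2
  using assms by (simp add: frob_inner_carrier sum.cartesian_product power2_eq_square
    case_prod_unfold)

lemma frob_inner_self_nonneg: "0 \<le> frob_inner A A"
  by (auto simp: frob_inner_def intro!: sum_nonneg)

lemma frob_inner_self_le:
  assumes "A \<in> op_ball m n R"
  shows "frob_inner A A \<le> real (min m n) * R\<^sup>2"
proof -
  have A: "A \<in> carrier_mat m n" "op_norm A \<le> R" using assms by (auto simp: op_ball_def)
  have "frob_inner A A \<le> real (min m n) * (op_norm A)\<^sup>2"
    using Frobenius_le_op_norm[OF A(1)] A by (simp add: frob_inner_carrier power2_eq_square)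
  also have "\<dots> \<le> real (min m n) * R\<^sup>2"
    by (intro mult_left_mono power_mono A op_norm_nonneg[OF A(1)]) simp
  finally show ?thesis .
qed

lemma frob_inner_step:
  assumes "A \<in> carrier_mat m n" "B \<in> carrier_mat m n" "C \<in> carrier_mat m n"
  shows "frob_inner (A - h \<cdot>\<^sub>m B - C) (A - h \<cdot>\<^sub>m B - C)
    = frob_inner (A - C) (A - C) - 2 * h * frob_inner B (A - C) + h\<^sup>2 * frob_inner B B"
proof -
  have "frob_inner (A - h \<cdot>\<^sub>m B - C) (A - h \<cdot>\<^sub>m B - C)
    = (\<Sum>i<m. \<Sum>j<n. (A - C) $$ (i, j) * (A - C) $$ (i, j) - 2 * h * (B $$ (i, j) * (A - C) $$ (i, j))
        + h\<^sup>2 * (B $$ (i, j) * B $$ (i, j)))"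
    using assms by (subst frob_inner_carrier[of _ m n])
      (auto intro!: sum.cong simp: algebra_simps power2_eq_square)
  also have "\<dots> = frob_inner (A - C) (A - C) - 2 * h * frob_inner B (A - C) + h\<^sup>2 * frob_inner B B"
    using assms by (simp add: frob_inner_carrier[of _ m n] frob_inner_minus[of _ m n]
      sum.distrib sum_subtractf sum_distrib_left)
  finally show ?thesis .
qed

lemma frob_inner_segment:
  assumes "A \<in> carrier_mat m n" "B \<in> carrier_mat m n" "C \<in> carrier_mat m n"
  shows "frob_inner (A - ((1 - t) \<cdot>\<^sub>m B + t \<cdot>\<^sub>m C)) (A - ((1 - t) \<cdot>\<^sub>m B + t \<cdot>\<^sub>m C))
    = frob_inner (A - B) (A - B) - 2 * t * frob_inner (A - B) (C - B) + t\<^sup>2 * frob_inner (C - B) (C - B)"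
proof -
  have "frob_inner (A - ((1 - t) \<cdot>\<^sub>m B + t \<cdot>\<^sub>m C)) (A - ((1 - t) \<cdot>\<^sub>m B + t \<cdot>\<^sub>m C))
    = (\<Sum>i<m. \<Sum>j<n. (A - B) $$ (i, j) * (A - B) $$ (i, j) - 2 * t * ((A - B) $$ (i, j) * (C - B) $$ (i, j))
        + t\<^sup>2 * ((C - B) $$ (i, j) * (C - B) $$ (i, j)))"
    using assms by (subst frob_inner_carrier[of _ m n])
      (auto intro!: sum.cong simp: algebra_simps power2_eq_square)
  also have "\<dots> = frob_inner (A - B) (A - B) - 2 * t * frob_inner (A - B) (C - B)
      + t\<^sup>2 * frob_inner (C - B) (C - B)"
    using assms by (simp add: frob_inner_minus[of _ m n] sum.distrib sum_subtractf sum_distrib_left)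
  finally show ?thesis .
qed

section \<open>Approximate projections onto the ball and the size of subgradients\<close>

lemma frob_inner_diff_self_le:
  assumes "A \<in> carrier_mat m n" "B \<in> carrier_mat m n"
  shows "frob_inner (A - B) (A - B) \<le> 2 * frob_inner A A + 2 * frob_inner B B"
proof -
  have "(A - B) $$ (i, j) * (A - B) $$ (i, j)
      \<le> 2 * (A $$ (i, j) * A $$ (i, j)) + 2 * (B $$ (i, j) * B $$ (i, j))" if "i < m" "j < n" for i j
    using that assms sum_squares_bound[of "A $$ (i, j)" "- B $$ (i, j)"]
    by (simp add: algebra_simps power2_eq_square)
  then have "frob_inner (A - B) (A - B)
      \<le> (\<Sum>i<m. \<Sum>j<n. 2 * (A $$ (i, j) * A $$ (i, j)) + 2 * (B $$ (i, j) * B $$ (i, j)))"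
    using assms by (subst frob_inner_carrier[of _ m n]) (auto intro!: sum_mono)
  also have "\<dots> = 2 * frob_inner A A + 2 * frob_inner B B"
    using assms by (simp add: frob_inner_carrier[of _ m n] sum.distrib sum_distrib_left)
  finally show ?thesis .
qed

text \<open>Take \<open>Y\<close> in the ball with squared distance to \<open>Z\<close> within
  \<open>t\<^sup>2\<close> of the infimum. Moving from \<open>Y\<close> by the fraction
  \<open>t\<close> towards \<open>U\<close> gains less than \<open>t\<^sup>2\<close>, which bounds
  the inner product of \<open>Z - Y\<close> and \<open>U - Y\<close> as in the variational
  inequality of an exact projection.\<close>

lemma approximate_projection:
  assumes "0 \<le> R" "0 < \<delta>" and Z: "Z \<in> carrier_mat m n"
  shows "\<exists>Y\<in>op_ball m n R. \<forall>U\<in>op_ball m n R.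
           frob_inner (Y - U) (Y - U) \<le> frob_inner (Z - U) (Z - U) + \<delta>"
proof -
  let ?B = "op_ball m n R"
  let ?d = "\<lambda>V. frob_inner (Z - V) (Z - V)"
  \<comment> \<open>\<open>D\<close> bounds the squared Frobenius diameter of the ball, and
    \<open>t\<close> is small enough for \<open>t * (D + 1) \<le> \<delta>\<close>. The added 1 pays
    for the \<open>t\<^sup>2\<close> of near-minimality.\<close>
  define D where "D = 4 * real (min m n) * R\<^sup>2"
  define t where "t = min 1 (\<delta> / (D + 1))"
  have D: "0 \<le> D" by (simp add: D_def)
  have t: "0 < t" "t \<le> 1" "t * (D + 1) \<le> \<delta>"
    using D \<open>0 < \<delta>\<close> by (auto simp: t_def min_def pos_le_divide_eq)
  have ne: "?B \<noteq> {}" using zero_in_op_ball[OF \<open>0 \<le> R\<close>] by blast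
  have bdd: "bdd_below (?d ` ?B)"
    by (rule bdd_belowI2[of _ 0]) (rule frob_inner_self_nonneg)
  have "(INF V\<in>?B. ?d V) < (INF V\<in>?B. ?d V) + t\<^sup>2" using t by simp
  then obtain Y where Y: "Y \<in> ?B" "?d Y < (INF V\<in>?B. ?d V) + t\<^sup>2"
    using cINF_less_iff[OF ne bdd] by blast
  show ?thesis
  proof (intro bexI[OF _ Y(1)] ballI)
    fix U assume U: "U \<in> ?B"
    let ?V = "(1 - t) \<cdot>\<^sub>m Y + t \<cdot>\<^sub>m U"
    have c: "Y \<in> carrier_mat m n" "U \<in> carrier_mat m n" using U Y by (auto simp: op_ball_def)
    have "?d Y < ?d ?V + t\<^sup>2"
      using Y(2) cINF_lower[OF bdd op_ball_convex[OF Y(1) U, of t]] t by simp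
    also have "?d ?V = ?d Y - 2 * t * frob_inner (Z - Y) (U - Y) + t\<^sup>2 * frob_inner (U - Y) (U - Y)"
      by (rule frob_inner_segment[OF Z c])
    also have "frob_inner (U - Y) (U - Y) \<le> D"
      using frob_inner_diff_self_le[OF c(2,1)] frob_inner_self_le[OF U] frob_inner_self_le[OF Y(1)]
      by (simp add: D_def)
    finally have "t * (2 * frob_inner (Z - Y) (U - Y)) < t * (t * (D + 1))"
      using t by (simp add: algebra_simps power2_eq_square mult_left_mono)
    then have *: "2 * frob_inner (Z - Y) (U - Y) \<le> \<delta>" using t by simp
    have "frob_inner (Y - U) (Y - U) = frob_inner (Z - U) (Z - U) - ?d Y + 2 * frob_inner (Z - Y) (U - Y)"
    proof -
      have eq: "Y - ((1 - 1) \<cdot>\<^sub>m Y + 1 \<cdot>\<^sub>m U) = Y - U" "Z - ((1 - 1) \<cdot>\<^sub>m Y + 1 \<cdot>\<^sub>m U) = Z - U"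
        using c Z by auto
      have "frob_inner (U - Y) (U - Y) = frob_inner (Y - U) (Y - U)"
        using c by (simp add: frob_inner_def algebra_simps)
      then show ?thesis
        using frob_inner_segment[OF Z c, of 1] eq by simp
    qed
    with * show "frob_inner (Y - U) (Y - U) \<le> frob_inner (Z - U) (Z - U) + \<delta>"
      using frob_inner_self_nonneg[of "Z - Y"] by simp
  qed
qed

text \<open>A short move from \<open>W\<close> along \<open>g\<close> raises \<open>f\<close> by at
  least \<open>t |g|^2\<close>, by the subgradient inequality, and by at most
  \<open>G t |g|\<close>, as the operator norm is below the Frobenius norm. The move may leave the
  ball, so the open set around it is essential.\<close>

lemma subgradient_bound:
  assumes f: "f \<in> op_class m n G R" and W: "W \<in> op_ball m n R"
    and g: "g \<in> subdifferential m n f W" and "0 \<le> G"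
  shows "frob_inner g g \<le> G\<^sup>2"
proof -
  have Wc: "W \<in> carrier_mat m n" using W by (simp add: op_ball_def)
  have gc: "g \<in> carrier_mat m n" and sub: "\<And>V. V \<in> carrier_mat m n \<Longrightarrow> f W + frob_inner g (V - W) \<le> f V"
    using g by (auto simp: subdifferential_def)
  obtain U where U: "openin (mat_topology m n) U" "W \<in> U" "op_lipschitz_on G U f"
    using f W by (auto simp: op_class_def)
  interpret Metric_space "carrier_mat m n" "frob_dist m n" by (rule Metric_space_frob_dist)
  obtain r where r: "r > 0" "mball W r \<subseteq> U"
    using U unfolding mat_topology_def openin_mtopology by blast
  define N where "N = L2_set (\<lambda>ij. g $$ ij) ({..<m} \<times> {..<n})"
  have gg: "frob_inner g g = N\<^sup>2" unfolding N_def by (rule frob_inner_self[OF gc])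
  have "N \<ge> 0" by (simp add: N_def)
  have "N \<le> G"
  proof (cases "N = 0")
    case False
    then have "N > 0" using \<open>N \<ge> 0\<close> by simp
    define t where "t = r / (2 * N)"
    have t: "t > 0" "t * N < r" using r \<open>N > 0\<close> by (auto simp: t_def)
    define V where "V = W + t \<cdot>\<^sub>m g"
    have Vc: "V \<in> carrier_mat m n" using Wc gc by (simp add: V_def)
    have VW: "V - W = t \<cdot>\<^sub>m g" using Wc gc by (auto simp: V_def)
    have L: "L2_set (\<lambda>ij. (t \<cdot>\<^sub>m g) $$ ij) ({..<m} \<times> {..<n}) = t * N"
    proof -
      have "L2_set (\<lambda>ij. (t \<cdot>\<^sub>m g) $$ ij) ({..<m} \<times> {..<n}) = L2_set (\<lambda>ij. t * g $$ ij) ({..<m} \<times> {..<n})"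
        using gc by (intro L2_set_cong) auto
      then show ?thesis using t by (simp add: N_def L2_set_right_distrib)
    qed
    have "frob_dist m n W V = t * N"
    proof -
      have "frob_dist m n V W = L2_set (\<lambda>ij. (t \<cdot>\<^sub>m g) $$ ij) ({..<m} \<times> {..<n})"
        unfolding frob_dist_def VW[symmetric] using Vc Wc by (intro L2_set_cong) auto
      then show ?thesis using L by (simp add: commute)
    qed
    then have "V \<in> U" using r t Vc Wc by (auto simp: mball_def)
    then have "f V - f W \<le> G * op_norm (V - W)"
      using U by (auto simp: op_lipschitz_on_def abs_le_iff)
    also have "op_norm (V - W) \<le> t * N"
      using op_norm_le_Frobenius[of "t \<cdot>\<^sub>m g" m n] gc by (simp add: VW L)
    finally have "f V - f W \<le> G * (t * N)" using \<open>0 \<le> G\<close> by (simp add: mult_left_mono)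
    moreover have "frob_inner g (V - W) = t * N\<^sup>2"
    proof -
      have "frob_inner g (t \<cdot>\<^sub>m g) = t * frob_inner g g"
        using gc by (simp add: frob_inner_def sum_distrib_left mult_ac)
      then show ?thesis by (simp add: VW gg)
    qed
    ultimately have "(t * N) * N \<le> (t * N) * G"
      using sub[OF Vc] by (simp add: power2_eq_square mult_ac)
    then show ?thesis using t \<open>N > 0\<close> by simp
  qed (use \<open>0 \<le> G\<close> in simp)
  then show ?thesis unfolding gg using \<open>N \<ge> 0\<close> by (rule power_mono)
qed

section \<open>The projected subgradient method\<close>

text \<open>An algorithm has to answer every transcript, also impossible ones, with a matrix of the
  right size. Hence membership in the ball stands outside the implication.\<close>

definition approx_proj :: "nat \<Rightarrow> nat \<Rightarrow> real \<Rightarrow> real \<Rightarrow> real mat \<Rightarrow> real mat" where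
  "approx_proj m n R \<delta> Z = (SOME Y. Y \<in> op_ball m n R \<and> (Z \<in> carrier_mat m n \<longrightarrow>
     (\<forall>U\<in>op_ball m n R. frob_inner (Y - U) (Y - U) \<le> frob_inner (Z - U) (Z - U) + \<delta>)))"

lemma approx_proj:
  assumes "0 \<le> R" "0 < \<delta>"
  shows approx_proj_in: "approx_proj m n R \<delta> Z \<in> op_ball m n R"
    and approx_proj_le: "Z \<in> carrier_mat m n \<Longrightarrow> U \<in> op_ball m n R \<Longrightarrow>
      frob_inner (approx_proj m n R \<delta> Z - U) (approx_proj m n R \<delta> Z - U)
        \<le> frob_inner (Z - U) (Z - U) + \<delta>"
proof -
  let ?P = "\<lambda>Y. Y \<in> op_ball m n R \<and> (Z \<in> carrier_mat m n \<longrightarrow>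
     (\<forall>U\<in>op_ball m n R. frob_inner (Y - U) (Y - U) \<le> frob_inner (Z - U) (Z - U) + \<delta>))"
  have "\<exists>Y. ?P Y"
    using approximate_projection[OF assms] zero_in_op_ball[OF assms(1)]
    by (cases "Z \<in> carrier_mat m n") blast+
  then have "?P (approx_proj m n R \<delta> Z)"
    unfolding approx_proj_def by (rule someI_ex)
  then show "approx_proj m n R \<delta> Z \<in> op_ball m n R" "Z \<in> carrier_mat m n \<Longrightarrow> U \<in> op_ball m n R \<Longrightarrow>
      frob_inner (approx_proj m n R \<delta> Z - U) (approx_proj m n R \<delta> Z - U)
        \<le> frob_inner (Z - U) (Z - U) + \<delta>"
    by blast+
qed

definition subgradient_step :: "nat \<Rightarrow> nat \<Rightarrow> real \<Rightarrow> real \<Rightarrow> real \<Rightarrow> transcript \<Rightarrow> real mat" where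
  "subgradient_step m n R h \<delta> p =
     (if p = [] then 0\<^sub>m m n
      else approx_proj m n R \<delta> (fst (last p) - h \<cdot>\<^sub>m snd (snd (last p))))"

text \<open>Again of the right size for every transcript; a query of least reported value as soon as
  there is a query and all of them have the right size.\<close>

definition best_query :: "nat \<Rightarrow> nat \<Rightarrow> transcript \<Rightarrow> real mat" where
  "best_query m n p = (SOME X. X \<in> carrier_mat m n \<and>
     (p \<noteq> [] \<and> fst ` set p \<subseteq> carrier_mat m n \<longrightarrow>
        (\<exists>v. (X, v) \<in> set p \<and> (\<forall>e\<in>set p. fst v \<le> fst (snd e)))))"

definition subgradient_method :: "nat \<Rightarrow> nat \<Rightarrow> real \<Rightarrow> real \<Rightarrow> real \<Rightarrow> nat \<Rightarrow> algorithm" where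
  "subgradient_method m n R h \<delta> T p =
     (if length p < T then Query (subgradient_step m n R h \<delta> p) else Stop (best_query m n p))"

lemma best_query:
  shows best_query_carrier: "best_query m n p \<in> carrier_mat m n"
    and best_query_least: "p \<noteq> [] \<Longrightarrow> fst ` set p \<subseteq> carrier_mat m n \<Longrightarrow>
      \<exists>v. (best_query m n p, v) \<in> set p \<and> (\<forall>e\<in>set p. fst v \<le> fst (snd e))"
proof -
  let ?P = "\<lambda>X. X \<in> carrier_mat m n \<and>
     (p \<noteq> [] \<and> fst ` set p \<subseteq> carrier_mat m n \<longrightarrow>
        (\<exists>v. (X, v) \<in> set p \<and> (\<forall>e\<in>set p. fst v \<le> fst (snd e))))"
  have "\<exists>X. ?P X"
  proof (cases "p \<noteq> [] \<and> fst ` set p \<subseteq> carrier_mat m n")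
    case True
    define e where "e = arg_min_on (\<lambda>e. fst (snd e)) (set p)"
    have "e \<in> set p" "\<forall>e'\<in>set p. fst (snd e) \<le> fst (snd e')"
      using True unfolding e_def
      by (auto intro: arg_min_if_finite(1) arg_min_least)
    then show ?thesis
      using True by (intro exI[of _ "fst e"] conjI impI exI[of _ "snd e"]) auto
  next
    case False
    then show ?thesis using zero_carrier_mat by blast
  qed
  then have "?P (best_query m n p)" unfolding best_query_def by (rule someI_ex)
  then show "best_query m n p \<in> carrier_mat m n" "p \<noteq> [] \<Longrightarrow> fst ` set p \<subseteq> carrier_mat m n \<Longrightarrow>
      \<exists>v. (best_query m n p, v) \<in> set p \<and> (\<forall>e\<in>set p. fst v \<le> fst (snd e))"
    by blast+
qed

lemma op_ball_carrier: "W \<in> op_ball m n R \<Longrightarrow> W \<in> carrier_mat m n"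
  by (simp add: op_ball_def)

lemma subgradient_step_in: "0 \<le> R \<Longrightarrow> 0 < \<delta> \<Longrightarrow> subgradient_step m n R h \<delta> p \<in> op_ball m n R"
  by (simp add: subgradient_step_def zero_in_op_ball approx_proj_in)

lemma subgradient_method_algorithm:
  "0 \<le> R \<Longrightarrow> 0 < \<delta> \<Longrightarrow> subgradient_method m n R h \<delta> T \<in> algorithms m n"
  by (auto simp: algorithms_def subgradient_method_def best_query_carrier
      intro: subgradient_step_in[THEN op_ball_carrier])

text \<open>The potential argument: each step lowers the squared Frobenius distance to any
  \<open>U\<close> of the ball by \<open>2 * h * (f X - f U)\<close>, up to the errors
  \<open>h\<^sup>2 * G\<^sup>2\<close> of the step and \<open>\<delta>\<close> of the projection.
  The initial distance, from the zero matrix, gives \<open>min m n * R\<^sup>2\<close>.\<close>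

lemma subgradient_method_run:
  assumes orc: "first_order_oracle m n (op_class m n G R) orc" and f: "f \<in> op_class m n G R"
    and pos: "0 \<le> G" "0 \<le> R" "0 < \<delta>" "0 < h" and "t \<le> T"
  shows "\<exists>p. reached orc (subgradient_method m n R h \<delta> T) f p \<and> length p = t \<and>
    (\<forall>e\<in>set p. fst e \<in> op_ball m n R \<and> fst (snd e) = f (fst e)) \<and>
    (\<forall>U\<in>op_ball m n R. 2 * h * (\<Sum>e\<leftarrow>p. fst (snd e) - f U)
        + frob_inner (subgradient_step m n R h \<delta> p - U) (subgradient_step m n R h \<delta> p - U)
      \<le> real (min m n) * R\<^sup>2 + real t * (h\<^sup>2 * G\<^sup>2 + \<delta>))"
  using \<open>t \<le> T\<close>
proof (induction t)
  case 0
  have "frob_inner (0\<^sub>m m n - U) (0\<^sub>m m n - U) \<le> real (min m n) * R\<^sup>2" if "U \<in> op_ball m n R" for U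
  proof -
    have "frob_inner (0\<^sub>m m n - U) (0\<^sub>m m n - U) = frob_inner U U"
      using op_ball_carrier[OF that] by (simp add: frob_inner_def)
    then show ?thesis using frob_inner_self_le[OF that] by simp
  qed
  then show ?case
    by (intro exI[of _ "[]"]) (auto simp: subgradient_step_def intro: reached.start)
next
  case (Suc t)
  let ?N = "subgradient_step m n R h \<delta>"
  obtain p where p: "reached orc (subgradient_method m n R h \<delta> T) f p" "length p = t"
      "\<And>e. e \<in> set p \<Longrightarrow> fst e \<in> op_ball m n R \<and> fst (snd e) = f (fst e)"
      "\<And>U. U \<in> op_ball m n R \<Longrightarrow> 2 * h * (\<Sum>e\<leftarrow>p. fst (snd e) - f U) + frob_inner (?N p - U) (?N p - U)
        \<le> real (min m n) * R\<^sup>2 + real t * (h\<^sup>2 * G\<^sup>2 + \<delta>)"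
    using Suc by auto
  define X where "X = ?N p"
  have X: "X \<in> op_ball m n R" using pos by (simp add: X_def subgradient_step_in)
  note Xc = op_ball_carrier[OF X]
  obtain g where g: "g \<in> subdifferential m n f X" "orc f X = (f X, g)"
    using orc f Xc by (auto simp: first_order_oracle_def)
  have gc: "g \<in> carrier_mat m n" using g by (simp add: subdifferential_def)
  define p' where "p' = p @ [(X, orc f X)]"
  have N: "?N p' = approx_proj m n R \<delta> (X - h \<cdot>\<^sub>m g)"
    by (simp add: subgradient_step_def p'_def g)
  have "reached orc (subgradient_method m n R h \<delta> T) f p'"
    unfolding p'_def using Suc.prems p by (intro reached.query) (auto simp: subgradient_method_def X_def)
  moreover have "2 * h * (\<Sum>e\<leftarrow>p'. fst (snd e) - f U) + frob_inner (?N p' - U) (?N p' - U)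
      \<le> real (min m n) * R\<^sup>2 + real (Suc t) * (h\<^sup>2 * G\<^sup>2 + \<delta>)" if U: "U \<in> op_ball m n R" for U
  proof -
    note Uc = op_ball_carrier[OF U]
    have "frob_inner (?N p' - U) (?N p' - U) \<le> frob_inner (X - h \<cdot>\<^sub>m g - U) (X - h \<cdot>\<^sub>m g - U) + \<delta>"
      unfolding N using Xc gc U pos by (intro approx_proj_le) auto
    also have "\<dots> = frob_inner (X - U) (X - U) - 2 * h * frob_inner g (X - U) + h\<^sup>2 * frob_inner g g + \<delta>"
      by (simp add: frob_inner_step[OF Xc gc Uc])
    finally have 1: "frob_inner (?N p' - U) (?N p' - U)
      \<le> frob_inner (X - U) (X - U) - 2 * h * frob_inner g (X - U) + h\<^sup>2 * frob_inner g g + \<delta>" .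
    have "f X + frob_inner g (U - X) \<le> f U"
      using g Uc by (auto simp: subdifferential_def)
    moreover have "frob_inner g (U - X) = - frob_inner g (X - U)"
      using gc Xc Uc by (simp add: frob_inner_def sum_negf[symmetric] algebra_simps)
    ultimately have "f X - f U \<le> frob_inner g (X - U)" by simp
    then have 2: "2 * h * (f X - f U) \<le> 2 * h * frob_inner g (X - U)"
      using pos by (intro mult_left_mono) auto
    have 3: "h\<^sup>2 * frob_inner g g \<le> h\<^sup>2 * G\<^sup>2"
      by (intro mult_left_mono subgradient_bound[OF f X g(1)] pos) simp
    have "(\<Sum>e\<leftarrow>p'. fst (snd e) - f U) = (\<Sum>e\<leftarrow>p. fst (snd e) - f U) + (f X - f U)"
      by (simp add: p'_def g)
    then have 4: "2 * h * (\<Sum>e\<leftarrow>p'. fst (snd e) - f U)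
        = 2 * h * (\<Sum>e\<leftarrow>p. fst (snd e) - f U) + 2 * h * (f X - f U)"
      by (simp add: ring_distribs)
    have 5: "real (Suc t) * (h\<^sup>2 * G\<^sup>2 + \<delta>) = real t * (h\<^sup>2 * G\<^sup>2 + \<delta>) + h\<^sup>2 * G\<^sup>2 + \<delta>"
      by (simp add: ring_distribs)
    show ?thesis using p(4)[OF U] 1 2 3 unfolding X_def[symmetric] 4 5 by linarith
  qed
  ultimately show ?case
    using p X by (intro exI[of _ p']) (auto simp: p'_def g)
qed

text \<open>The least reported value is at most the average. The bound holds against every
  \<open>U\<close> of the ball and so passes to the infimum.\<close>

lemma wcc_upper_bound:
  assumes orc: "first_order_oracle m n (op_class m n G R) orc"
    and pos: "0 < G" "0 < R" "0 < \<epsilon>" and T: "2 * real (min m n) * (G * R / \<epsilon>)\<^sup>2 \<le> real T" "0 < T"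
  shows "wcc m n (op_ball m n R) (op_class m n G R) orc \<epsilon> \<le> of_nat T"
proof -
  \<comment> \<open>With these values one step costs
    \<open>h\<^sup>2 * G\<^sup>2 + \<delta> = h * (3 * \<epsilon> / 2)\<close>, and \<open>T\<close>
    is large enough for the initial distance to cost at most
    \<open>h * T * (\<epsilon> / 2)\<close>. The total is
    \<open>2 * h * T * \<epsilon>\<close>.\<close>
  define h where "h = \<epsilon> / G\<^sup>2"
  define \<delta> where "\<delta> = \<epsilon>\<^sup>2 / (2 * G\<^sup>2)"
  let ?A = "subgradient_method m n R h \<delta> T"
  have h: "0 < h" "0 < \<delta>" using pos by (auto simp: h_def \<delta>_def)
  have "oracle_calls (op_ball m n R) orc ?A f \<epsilon> \<le> of_nat T" if f: "f \<in> op_class m n G R" for f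
  proof -
    obtain p where p: "reached orc ?A f p" "length p = T"
      "\<And>e. e \<in> set p \<Longrightarrow> fst e \<in> op_ball m n R \<and> fst (snd e) = f (fst e)"
      "\<And>U. U \<in> op_ball m n R \<Longrightarrow> 2 * h * (\<Sum>e\<leftarrow>p. fst (snd e) - f U)
        + frob_inner (subgradient_step m n R h \<delta> p - U) (subgradient_step m n R h \<delta> p - U)
        \<le> real (min m n) * R\<^sup>2 + real T * (h\<^sup>2 * G\<^sup>2 + \<delta>)"
      using subgradient_method_run[OF orc f _ _ h(2,1), of T T] pos by auto
    define X where "X = best_query m n p"
    have "p \<noteq> []" using p T by auto
    moreover have "fst ` set p \<subseteq> carrier_mat m n"
      using p(3) op_ball_carrier by fastforce
    ultimately have "\<exists>v. (X, v) \<in> set p \<and> (\<forall>e\<in>set p. fst v \<le> fst (snd e))"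
      unfolding X_def by (rule best_query_least)
    then obtain v where v: "(X, v) \<in> set p" "\<forall>e\<in>set p. fst v \<le> fst (snd e)"
      by (elim exE conjE)
    have fX: "fst v = f X" using p(3)[OF v(1)] by simp
    have "f X - \<epsilon> \<le> f U" if U: "U \<in> op_ball m n R" for U
    proof -
      have "(\<Sum>e\<leftarrow>p. f X - f U) \<le> (\<Sum>e\<leftarrow>p. fst (snd e) - f U)"
        using v fX by (intro sum_list_mono) auto
      then have "real T * (f X - f U) \<le> (\<Sum>e\<leftarrow>p. fst (snd e) - f U)"
        using p(2) by (simp add: sum_list_triv)
      then have "2 * h * (real T * (f X - f U)) \<le> 2 * h * (\<Sum>e\<leftarrow>p. fst (snd e) - f U)"
        using h by (intro mult_left_mono) auto
      also have "\<dots> \<le> real (min m n) * R\<^sup>2 + real T * (h\<^sup>2 * G\<^sup>2 + \<delta>)"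
        using p(4)[OF U] frob_inner_self_nonneg[of "subgradient_step m n R h \<delta> p - U"] by linarith
      also have "real (min m n) * R\<^sup>2 \<le> h * real T * (\<epsilon> / 2)"
      proof -
        have "2 * (real (min m n) * R\<^sup>2) * G\<^sup>2 \<le> real T * \<epsilon>\<^sup>2"
          using T(1) pos by (simp add: field_simps power_mult_distrib power_divide)
        then show ?thesis using pos by (simp add: h_def field_simps power2_eq_square)
      qed
      also have "real T * (h\<^sup>2 * G\<^sup>2 + \<delta>) = h * real T * (3 * \<epsilon> / 2)"
        using pos by (simp add: h_def \<delta>_def field_simps power2_eq_square)
      finally have "(2 * h * real T) * (f X - f U) \<le> (2 * h * real T) * \<epsilon>"
        by (simp add: algebra_simps)
      then show ?thesis using h T by (simp add: mult_le_cancel_left)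
    qed
    then have "f X - \<epsilon> \<le> (INF U\<in>op_ball m n R. f U)"
      using zero_in_op_ball[of R m n] pos by (intro cINF_greatest) auto
    then have "f X - (INF U\<in>op_ball m n R. f U) \<le> \<epsilon>" by simp
    then show ?thesis
      unfolding oracle_calls_def using p
      by (intro Inf_lower) (auto intro!: exI[of _ p] exI[of _ X] simp: subgradient_method_def X_def)
  qed
  moreover have "?A \<in> algorithms m n"
    using pos h by (intro subgradient_method_algorithm) auto
  ultimately show ?thesis
    unfolding wcc_def by (intro INF_lower2[of ?A] SUP_least)
qed

text \<open>For a fixed algorithm an average is at most the supremum.\<close>

lemma dc_le_wcc: "dc m n \<X> F orc \<epsilon> \<le> wcc m n \<X> F orc \<epsilon>"
  unfolding dc_def wcc_def
proof (intro SUP_least INF_mono bexI)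
  fix P and A :: algorithm
  assume "P \<in> distributions_on F" "A \<in> algorithms m n"
  then interpret prob_space P by (simp add: distributions_on_def)
  have P: "space P = F" using \<open>P \<in> distributions_on F\<close> by (simp add: distributions_on_def)
  have "(\<integral>\<^sup>+ f. oracle_calls \<X> orc A f \<epsilon> \<partial>P) \<le> (\<integral>\<^sup>+ f. (SUP f\<in>F. oracle_calls \<X> orc A f \<epsilon>) \<partial>P)"
    by (intro nn_integral_mono SUP_upper) (simp add: P)
  then show "(\<integral>\<^sup>+ f. oracle_calls \<X> orc A f \<epsilon> \<partial>P) \<le> (SUP f\<in>F. oracle_calls \<X> orc A f \<epsilon>)"
    by (simp add: emeasure_space_1)
qed

section \<open>Sign matrices of small operator norm\<close>

text \<open>This is \<open>cosh x \<le> exp (x\<^sup>2 / 2)\<close>, obtained from Hoeffding's lemma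
  for probability 1/2 and width \<open>2 * x\<close>.\<close>

lemma exp_plus_exp_minus_le: "exp x + exp (- x) \<le> 2 * exp (x\<^sup>2 / 2)" for x :: real
proof -
  have *: "exp x + exp (- x) \<le> 2 * exp (x\<^sup>2 / 2)" if "x \<ge> 0" for x :: real
  proof -
    have pos: "1 + 1 / 2 * (exp (2 * x) - 1) > (0::real)" using that by (simp add: field_simps add_pos_pos)
    have "ln (1 + 1 / 2 * (exp (2 * x) - 1)) \<le> x + x\<^sup>2 / 2"
      using Hoeffdings_lemma_aux[of "2 * x" "1 / 2"] that by (simp add: power2_eq_square)
    then have "1 + 1 / 2 * (exp (2 * x) - 1) \<le> exp (x + x\<^sup>2 / 2)"
      using pos by (metis exp_le_cancel_iff exp_ln)
    then have "exp (- x) * (1 + exp (2 * x)) \<le> exp (- x) * (2 * exp (x + x\<^sup>2 / 2))"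
      by (intro mult_left_mono) (auto simp: field_simps)
    moreover have "exp (- x) * exp (2 * x) = exp x" "exp (- x) * exp (x + x\<^sup>2 / 2) = exp (x\<^sup>2 / 2)"
      by (simp_all add: exp_add[symmetric])
    ultimately show ?thesis by (simp add: algebra_simps)
  qed
  show ?thesis
    using *[of x] *[of "- x"] by (cases "x \<ge> 0") auto
qed

text \<open>Hoeffding's inequality as a count: the moment generating function of the sum factorises
  over \<open>J\<close>, and the Chernoff parameter is \<open>t\<close> itself.\<close>

lemma card_Rademacher_tail:
  fixes c :: "'a \<Rightarrow> real"
  assumes J: "finite J" and c: "(\<Sum>e\<in>J. (c e)\<^sup>2) \<le> 1" and "0 \<le> t"
  shows "real (card {\<xi> \<in> PiE J (\<lambda>_. {-1, 1}). t < (\<Sum>e\<in>J. \<xi> e * c e)})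
    \<le> 2 ^ card J * exp (- t\<^sup>2 / 2)"
proof -
  let ?X = "PiE J (\<lambda>_. {-1, 1 :: real})"
  let ?S = "\<lambda>\<xi>. \<Sum>e\<in>J. \<xi> e * c e"
  have fin: "finite ?X" using J by (intro finite_PiE) auto
  have "real (card {\<xi> \<in> ?X. t < ?S \<xi>}) * exp (t * t) = (\<Sum>\<xi>\<in>{\<xi> \<in> ?X. t < ?S \<xi>}. exp (t * t))"
    by simp
  also have "\<dots> \<le> (\<Sum>\<xi>\<in>{\<xi> \<in> ?X. t < ?S \<xi>}. exp (t * ?S \<xi>))"
    using \<open>0 \<le> t\<close> by (intro sum_mono) (auto intro!: mult_left_mono)
  also have "\<dots> \<le> (\<Sum>\<xi>\<in>?X. exp (t * ?S \<xi>))"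
    using fin by (intro sum_mono2) auto
  also have "\<dots> = (\<Sum>\<xi>\<in>?X. \<Prod>e\<in>J. exp (t * (\<xi> e * c e)))"
    using J by (simp add: exp_sum sum_distrib_left)
  also have "\<dots> = (\<Prod>e\<in>J. \<Sum>s\<in>{-1, 1}. exp (t * (s * c e)))"
    using J by (intro prod_sum_PiE[symmetric]) auto
  also have "\<dots> = (\<Prod>e\<in>J. exp (t * c e) + exp (- (t * c e)))"
    by (intro prod.cong) auto
  also have "\<dots> \<le> (\<Prod>e\<in>J. 2 * exp ((t * c e)\<^sup>2 / 2))"
    by (intro prod_mono conjI exp_plus_exp_minus_le) (simp add: add_nonneg_nonneg)
  also have "\<dots> = 2 ^ card J * exp (\<Sum>e\<in>J. (t * c e)\<^sup>2 / 2)"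
    using J by (simp add: prod.distrib exp_sum)
  also have "(\<Sum>e\<in>J. (t * c e)\<^sup>2 / 2) = t\<^sup>2 / 2 * (\<Sum>e\<in>J. (c e)\<^sup>2)"
    by (simp add: power_mult_distrib sum_distrib_left)
  also have "2 ^ card J * exp (t\<^sup>2 / 2 * (\<Sum>e\<in>J. (c e)\<^sup>2)) \<le> 2 ^ card J * exp (t\<^sup>2 / 2)"
    using c by (intro mult_left_mono) (auto intro!: mult_left_le)
  finally have "real (card {\<xi> \<in> ?X. t < ?S \<xi>}) \<le> 2 ^ card J * exp (t\<^sup>2 / 2) / exp (t * t)"
    by (simp add: pos_le_divide_eq)
  also have "\<dots> = 2 ^ card J * exp (- t\<^sup>2 / 2)"
    by (simp add: exp_diff[symmetric] power2_eq_square flip: times_divide_eq_right)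
  finally show ?thesis .
qed

section \<open>A finite net of the Euclidean ball\<close>

text \<open>Integer coordinates on the grid of mesh \<open>1 / (4 * sqrt a)\<close>; the bound on
  the squares says that \<open>net_vector a w\<close> lies in the unit ball. The box places the set
  in a finite \<open>PiE\<close>.\<close>

definition lattice_net :: "nat \<Rightarrow> (nat \<Rightarrow> int) set" where
  "lattice_net a = {w \<in> PiE {..<a} (\<lambda>_. {- int (16 * a)..int (16 * a)}). (\<Sum>i<a. (w i)\<^sup>2) \<le> int (16 * a)}"

definition net_vector :: "nat \<Rightarrow> (nat \<Rightarrow> int) \<Rightarrow> nat \<Rightarrow> real" where
  "net_vector a w i = real_of_int (w i) / (4 * sqrt (real a))"

lemma finite_lattice_net: "finite (lattice_net a)"
  unfolding lattice_net_def
  by (rule finite_subset[OF Collect_subset]) (rule finite_PiE, simp_all)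

lemma abs_le_square_int: "\<bar>k\<bar> \<le> k\<^sup>2" for k :: int
proof (cases "k = 0")
  case False
  then have "\<bar>k\<bar> * 1 \<le> \<bar>k\<bar> * \<bar>k\<bar>" by (intro mult_left_mono) auto
  then show ?thesis by (simp add: power2_eq_square)
qed simp

lemma sum_half_power_abs:
  "(\<Sum>k\<in>{- int T..int T}. (1 / 2 :: real) ^ nat \<bar>k\<bar>) = 3 - 2 * (1 / 2) ^ T"
proof (induction T)
  case (Suc T)
  have "{- int (Suc T)..int (Suc T)} = insert (- int (Suc T)) (insert (int (Suc T)) {- int T..int T})"
    by auto
  moreover have "nat \<bar>- int (Suc T)\<bar> = Suc T" "nat \<bar>int (Suc T)\<bar> = Suc T" by simp_all
  ultimately show ?case using Suc by simp
qed simp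

text \<open>Each member has weight \<open>2\<close> to the power \<open>- \<Sum>\<bar>w\<^sub>i\<bar> \<ge> - 16 a\<close>, and the total weight of all
  integer vectors is at most \<open>3\<close> to the power \<open>a\<close>.\<close>

lemma card_lattice_net: "real (card (lattice_net a)) \<le> 2 ^ (18 * a)"
proof -
  let ?P = "PiE {..<a} (\<lambda>_. {- int (16 * a)..int (16 * a)})"
  have finP: "finite ?P" by (rule finite_PiE) simp_all
  have sub: "lattice_net a \<subseteq> ?P" by (simp add: lattice_net_def)
  \<comment> \<open>The limit 3 is rounded up to \<open>4 = 2 ^ 2\<close>, which makes the final
    exponent of 2 equal to \<open>16 * a + 2 * a = 18 * a\<close>.\<close>
  have le4: "0 \<le> s \<and> s \<le> 4" if "s = (\<Sum>k\<in>{- int T..int T}. (1 / 2 :: real) ^ nat \<bar>k\<bar>)" for s T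
  proof
    show "0 \<le> s" unfolding that by (rule sum_nonneg) simp
    have "0 \<le> (1 / 2 :: real) ^ T" by simp
    then show "s \<le> 4" unfolding that sum_half_power_abs by linarith
  qed
  have "real (card (lattice_net a)) = (\<Sum>w\<in>lattice_net a. 1)" by simp
  also have "\<dots> \<le> (\<Sum>w\<in>lattice_net a. 2 ^ (16 * a) * (\<Prod>i<a. (1 / 2) ^ nat \<bar>w i\<bar>))"
  proof (intro sum_mono)
    fix w assume w: "w \<in> lattice_net a"
    have "int (\<Sum>i<a. nat \<bar>w i\<bar>) = (\<Sum>i<a. \<bar>w i\<bar>)" by simp
    also have "\<dots> \<le> (\<Sum>i<a. (w i)\<^sup>2)"
      by (intro sum_mono abs_le_square_int)
    also have "\<dots> \<le> int (16 * a)" using w by (simp add: lattice_net_def)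
    finally have le: "(\<Sum>i<a. nat \<bar>w i\<bar>) \<le> 16 * a" by linarith
    have "(1::real) = 2 ^ (16 * a) * (1 / 2) ^ (16 * a)"
      by (simp add: power_mult_distrib[symmetric])
    also have "\<dots> \<le> 2 ^ (16 * a) * (1 / 2) ^ (\<Sum>i<a. nat \<bar>w i\<bar>)"
      by (intro mult_left_mono power_decreasing le) auto
    finally show "1 \<le> 2 ^ (16 * a) * (\<Prod>i<a. (1 / 2 :: real) ^ nat \<bar>w i\<bar>)"
      by (simp add: power_sum)
  qed
  also have "\<dots> \<le> (\<Sum>w\<in>?P. 2 ^ (16 * a) * (\<Prod>i<a. (1 / 2) ^ nat \<bar>w i\<bar>))"
    by (rule sum_mono2[OF finP sub]) (simp add: prod_nonneg)
  also have "\<dots> = 2 ^ (16 * a) * (\<Prod>i<a. \<Sum>k\<in>{- int (16 * a)..int (16 * a)}. (1 / 2) ^ nat \<bar>k\<bar>)"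
    unfolding sum_distrib_left[symmetric] by (subst prod_sum_PiE) simp_all
  also have "\<dots> \<le> 2 ^ (16 * a) * (\<Prod>i<a. 4)"
    by (intro mult_left_mono prod_mono le4[OF refl]) simp
  also have "(\<Prod>i<a. (4::real)) = 2 ^ (2 * a)"
    by (subst power_mult) simp
  also have "2 ^ (16 * a) * (2::real) ^ (2 * a) = 2 ^ (18 * a)"
    by (simp add: power_add[symmetric])
  finally show ?thesis .
qed

lemma net_vector_norm:
  assumes "w \<in> lattice_net a"
  shows "(\<Sum>i<a. (net_vector a w i)\<^sup>2) \<le> 1"
proof -
  have "real_of_int (\<Sum>i<a. (w i)\<^sup>2) \<le> real_of_int (int (16 * a))"
    using assms unfolding lattice_net_def of_int_le_iff by simp
  then have "(\<Sum>i<a. (real_of_int (w i))\<^sup>2) \<le> 16 * real a" by simp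
  moreover have "(\<Sum>i<a. (net_vector a w i)\<^sup>2) = (\<Sum>i<a. (real_of_int (w i))\<^sup>2) / (16 * real a)"
    by (simp add: net_vector_def power_divide power_mult_distrib sum_divide_distrib)
  ultimately show ?thesis by (simp add: divide_le_eq)
qed

text \<open>Rounding towards zero, so that absolute values do not grow and a rounded point of the
  ball stays in the ball.\<close>

lemma truncate_real:
  obtains k :: int where "\<bar>real_of_int k\<bar> \<le> \<bar>r\<bar>" "\<bar>r - real_of_int k\<bar> \<le> 1"
proof (cases "r \<ge> 0")
  case True
  then have "0 \<le> \<lfloor>r\<rfloor>" by simp
  then show ?thesis using True by (intro that[of "\<lfloor>r\<rfloor>"]) linarith+
next
  case False
  then have "\<lceil>r\<rceil> \<le> 0" by simp
  then show ?thesis using False by (intro that[of "\<lceil>r\<rceil>"]) linarith+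
qed

text \<open>Rounding \<open>4 * sqrt a * x\<close> costs at most \<open>1 / (4 * sqrt a)\<close> in
  each of the \<open>a\<close> coordinates of \<open>x\<close>, hence at most 1/4 in norm.\<close>

lemma lattice_net_approx:
  assumes a: "0 < a" and x: "(\<Sum>i<a. (x i)\<^sup>2) \<le> 1"
  shows "\<exists>w\<in>lattice_net a. L2_set (\<lambda>i. x i - net_vector a w i) {..<a} \<le> 1 / 4"
proof -
  let ?s = "4 * sqrt (real a)"
  have s: "?s > 0" using a by simp
  have "\<forall>i. \<exists>k::int. \<bar>real_of_int k\<bar> \<le> \<bar>?s * x i\<bar> \<and> \<bar>?s * x i - real_of_int k\<bar> \<le> 1"
    using truncate_real by metis
  then obtain k where k: "\<And>i. \<bar>real_of_int (k i)\<bar> \<le> \<bar>?s * x i\<bar>" "\<And>i. \<bar>?s * x i - real_of_int (k i)\<bar> \<le> 1"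
    by metis
  define w where "w = restrict k {..<a}"
  have "real_of_int (\<Sum>i<a. (w i)\<^sup>2) = (\<Sum>i<a. (real_of_int (k i))\<^sup>2)"
    by (simp add: w_def)
  also have "\<dots> \<le> (\<Sum>i<a. (?s * x i)\<^sup>2)"
    by (intro sum_mono) (use k(1) in \<open>simp add: abs_le_square_iff\<close>)
  also have "\<dots> = 16 * real a * (\<Sum>i<a. (x i)\<^sup>2)"
    by (simp add: power_mult_distrib sum_distrib_left)
  also have "\<dots> \<le> 16 * real a * 1"
    using x by (intro mult_left_mono) auto
  finally have sq: "(\<Sum>i<a. (w i)\<^sup>2) \<le> int (16 * a)" by linarith
  have bound: "- int (16 * a) \<le> w i \<and> w i \<le> int (16 * a)" if "i < a" for i
  proof -
    have "\<bar>w i\<bar> \<le> (w i)\<^sup>2" by (rule abs_le_square_int)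
    also have "\<dots> \<le> (\<Sum>i<a. (w i)\<^sup>2)" using that by (intro member_le_sum) auto
    finally show ?thesis using sq by linarith
  qed
  have "w \<in> lattice_net a"
    unfolding lattice_net_def using sq bound by (auto simp: w_def)
  moreover have "L2_set (\<lambda>i. x i - net_vector a w i) {..<a} \<le> 1 / 4"
  proof -
    have "\<bar>x i - net_vector a w i\<bar> \<le> 1 / ?s" if "i < a" for i
    proof -
      have "x i - net_vector a w i = (?s * x i - real_of_int (k i)) / ?s"
        using s that by (simp add: net_vector_def w_def field_simps)
      then show ?thesis using k(2)[of i] s by (simp add: abs_mult divide_right_mono)
    qed
    then have "L2_set (\<lambda>i. \<bar>x i - net_vector a w i\<bar>) {..<a} \<le> L2_set (\<lambda>i. 1 / ?s) {..<a}"
      by (intro L2_set_mono) auto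
    also have "\<dots> = 1 / 4" using a by (simp add: L2_set_constant)
    finally show ?thesis by (simp add: L2_set_def)
  qed
  ultimately show ?thesis by blast
qed

section \<open>Most sign matrices have small norm\<close>

lemma op_norm_leI_unit:
  assumes A: "A \<in> carrier_mat m n" and c: "0 \<le> c"
    and le: "\<And>x y. L2_set x {..<m} = 1 \<Longrightarrow> L2_set y {..<n} = 1 \<Longrightarrow>
      (\<Sum>i<m. \<Sum>j<n. A $$ (i, j) * x i * y j) \<le> c"
  shows "op_norm A \<le> c"
proof (rule op_norm_leI[OF A c])
  fix x y :: "nat \<Rightarrow> real"
  let ?X = "L2_set x {..<m}" and ?Y = "L2_set y {..<n}"
  show "(\<Sum>i<m. \<Sum>j<n. A $$ (i, j) * x i * y j) \<le> c * ?X * ?Y"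
  proof (cases "?X = 0 \<or> ?Y = 0")
    case True
    then have "(\<Sum>i<m. \<Sum>j<n. A $$ (i, j) * x i * y j) = 0"
      by (intro sum.neutral ballI) (auto simp: L2_set_eq_0_iff)
    with True show ?thesis by auto
  next
    case False
    have pos: "?X > 0" "?Y > 0"
      using False L2_set_nonneg[of x "{..<m}"] L2_set_nonneg[of y "{..<n}"] by (auto simp: less_le)
    have "L2_set (\<lambda>i. x i * (1 / ?X)) {..<m} = 1" "L2_set (\<lambda>j. y j * (1 / ?Y)) {..<n} = 1"
      using pos L2_set_left_distrib[of "1 / ?X" x "{..<m}"] L2_set_left_distrib[of "1 / ?Y" y "{..<n}"]
      by simp_all
    from le[OF this] have "(\<Sum>i<m. \<Sum>j<n. (A $$ (i, j) * x i * y j) * (1 / (?X * ?Y))) \<le> c"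
      by (simp add: mult_ac)
    then have "(\<Sum>i<m. \<Sum>j<n. A $$ (i, j) * x i * y j) * (1 / (?X * ?Y)) \<le> c"
      unfolding sum_distrib_right .
    then show ?thesis using pos by (simp add: field_simps)
  qed
qed

text \<open>A union bound over pairs of net vectors, then the passage from the net to all vectors.
  The conclusion is about bilinear forms because this is what block matrices take up.\<close>

lemma sign_matrices_small_op_norm:
  assumes a: "0 < a" and b: "0 < b"
  shows "\<exists>Gd \<subseteq> PiE ({..<a} \<times> {..<b}) (\<lambda>_. {-1, 1}). 2 ^ (a * b) \<le> 2 * card Gd \<and>
    (\<forall>\<xi>\<in>Gd. \<forall>x y. (\<Sum>i<a. \<Sum>j<b. \<xi> (i, j) * x i * y j)
       \<le> sqrt (152 * real (a + b)) * L2_set x {..<a} * L2_set y {..<b})"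
proof -
  let ?J = "{..<a} \<times> {..<b}"
  let ?X = "PiE ?J (\<lambda>_. {-1, 1 :: real})"
  let ?c = "\<lambda>w v e. net_vector a w (fst e) * net_vector b v (snd e)"
  \<comment> \<open>Chosen with \<open>t\<^sup>2 / 2 = 19 * (a + b)\<close>. There are at most
    \<open>2 ^ (18 * (a + b))\<close> pairs of net vectors, each with at most a fraction
    \<open>exp (- 19 * (a + b))\<close> of bad patterns; as \<open>exp 1 \<ge> 2\<close>, at most
    half of all patterns are bad.\<close>
  define t where "t = sqrt (38 * real (a + b))"
  let ?bad = "\<lambda>w v. {\<xi> \<in> ?X. t < (\<Sum>e\<in>?J. \<xi> e * ?c w v e)}"
  define Bad where "Bad = (\<Union>(w, v)\<in>lattice_net a \<times> lattice_net b. ?bad w v)"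
  have finX: "finite ?X" by (intro finite_PiE) auto
  have cX: "card ?X = 2 ^ (a * b)" by (simp add: card_PiE card_cartesian_product numeral_2_eq_2)
  have t: "0 \<le> t" "t\<^sup>2 = 38 * real (a + b)" by (simp_all add: t_def)
  have bad: "real (card (?bad w v)) \<le> 2 ^ (a * b) * exp (- t\<^sup>2 / 2)"
    if "w \<in> lattice_net a" "v \<in> lattice_net b" for w v
  proof -
    have "(\<Sum>e\<in>?J. (?c w v e)\<^sup>2) = (\<Sum>i<a. (net_vector a w i)\<^sup>2) * (\<Sum>j<b. (net_vector b v j)\<^sup>2)"
      by (simp add: sum_product sum.cartesian_product power_mult_distrib case_prod_unfold)
    also have "\<dots> \<le> 1 * 1"
      by (intro mult_mono net_vector_norm that sum_nonneg) auto
    finally show ?thesis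
      using card_Rademacher_tail[of ?J "?c w v" t] t by (simp add: card_cartesian_product)
  qed
  have "real (card Bad) \<le> (\<Sum>(w, v)\<in>lattice_net a \<times> lattice_net b. real (card (?bad w v)))"
    unfolding Bad_def case_prod_unfold of_nat_sum[symmetric] of_nat_le_iff
    by (intro card_UN_le finite_cartesian_product finite_lattice_net)
  also have "\<dots> \<le> (\<Sum>(w, v)\<in>lattice_net a \<times> lattice_net b. 2 ^ (a * b) * exp (- t\<^sup>2 / 2))"
  proof (intro sum_mono)
    fix p assume "p \<in> lattice_net a \<times> lattice_net b"
    then show "(case p of (w, v) \<Rightarrow> real (card (?bad w v))) \<le> (case p of (w, v) \<Rightarrow> 2 ^ (a * b) * exp (- t\<^sup>2 / 2))"
      using bad[of "fst p" "snd p"] by (auto simp: case_prod_unfold)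
  qed
  also have "\<dots> = real (card (lattice_net a)) * real (card (lattice_net b)) * (2 ^ (a * b) * exp (- t\<^sup>2 / 2))"
    by (simp add: card_cartesian_product)
  also have "\<dots> \<le> 2 ^ (18 * a) * 2 ^ (18 * b) * (2 ^ (a * b) * exp (- t\<^sup>2 / 2))"
    by (intro mult_right_mono mult_mono card_lattice_net) auto
  also have "exp (- t\<^sup>2 / 2) = 1 / exp 1 ^ (19 * (a + b))"
  proof -
    have "- t\<^sup>2 / 2 = - (real (19 * (a + b)) * 1)" by (simp add: t)
    then show ?thesis by (simp only: exp_minus exp_of_nat_mult inverse_eq_divide)
  qed
  also have "1 / exp 1 ^ (19 * (a + b)) \<le> 1 / (2 ^ (19 * (a + b)) :: real)"
    using exp_ge_add_one_self[of 1] by (intro divide_left_mono power_mono) auto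
  also have "2 ^ (18 * a) * 2 ^ (18 * b) * (2 ^ (a * b) * (1 / (2 ^ (19 * (a + b)) :: real)))
      = 2 ^ (a * b) / 2 ^ (a + b)"
  proof -
    have "(2::real) ^ (19 * (a + b)) = 2 ^ (18 * a) * 2 ^ (18 * b) * 2 ^ (a + b)"
      by (simp add: power_add[symmetric] algebra_simps)
    then show ?thesis by simp
  qed
  also have "\<dots> \<le> 2 ^ (a * b) / 2 ^ 1"
    using a by (intro divide_left_mono power_increasing) auto
  finally have cB: "2 * real (card Bad) \<le> 2 ^ (a * b)" by simp
  have BX: "Bad \<subseteq> ?X" by (auto simp: Bad_def)
  have "card (?X - Bad) = card ?X - card Bad" "card Bad \<le> card ?X"
    using BX finX by (auto intro!: card_Diff_subset card_mono finite_subset[of Bad ?X])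
  moreover have "2 * card Bad \<le> 2 ^ (a * b)"
    using cB by (simp flip: of_nat_le_iff[where 'a = real])
  ultimately have cG: "2 ^ (a * b) \<le> 2 * card (?X - Bad)" using cX by linarith
  have "(\<Sum>i<a. \<Sum>j<b. \<xi> (i, j) * x i * y j) \<le> sqrt (152 * real (a + b)) * L2_set x {..<a} * L2_set y {..<b}"
    if \<xi>: "\<xi> \<in> ?X - Bad" for \<xi> x y
  proof -
    define A where "A = mat a b \<xi>"
    have A: "A \<in> carrier_mat a b" by (simp add: A_def)
    have AJ: "(\<Sum>i<a. \<Sum>j<b. A $$ (i, j) * x i * y j) = (\<Sum>i<a. \<Sum>j<b. \<xi> (i, j) * x i * y j)" for x y
      by (simp add: A_def)
    have net: "(\<Sum>i<a. \<Sum>j<b. A $$ (i, j) * net_vector a w i * net_vector b v j) \<le> t"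
      if "w \<in> lattice_net a" "v \<in> lattice_net b" for w v
    proof -
      have "\<xi> \<notin> ?bad w v" using \<xi> that by (auto simp: Bad_def)
      moreover have "(\<Sum>i<a. \<Sum>j<b. A $$ (i, j) * net_vector a w i * net_vector b v j)
          = (\<Sum>e\<in>?J. \<xi> e * ?c w v e)"
        unfolding AJ by (simp add: sum.cartesian_product case_prod_unfold mult_ac)
      ultimately show ?thesis using \<xi> by (simp add: not_less)
    qed
    \<comment> \<open>Replacing \<open>x\<close> and then \<open>y\<close> by net vectors at
      distance at most 1/4 costs at most \<open>op_norm A / 4\<close> each time. Absorbing the norm
      on the right leaves \<open>2 * t\<close>.\<close>
    have "op_norm A \<le> t + op_norm A / 2"
    proof (rule op_norm_leI_unit[OF A])
      show "0 \<le> t + op_norm A / 2" using t op_norm_nonneg[OF A] by simp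
      fix x y :: "nat \<Rightarrow> real" assume x: "L2_set x {..<a} = 1" and y: "L2_set y {..<b} = 1"
      obtain w where w: "w \<in> lattice_net a" "L2_set (\<lambda>i. x i - net_vector a w i) {..<a} \<le> 1 / 4"
        using lattice_net_approx[OF a, of x] x L2_set_power2[of x "{..<a}"] by auto
      obtain v where v: "v \<in> lattice_net b" "L2_set (\<lambda>j. y j - net_vector b v j) {..<b} \<le> 1 / 4"
        using lattice_net_approx[OF b, of y] y L2_set_power2[of y "{..<b}"] by auto
      have wn: "L2_set (net_vector a w) {..<a} \<le> 1"
        using net_vector_norm[OF w(1)] by (simp add: L2_set_def)
      let ?B = "\<lambda>x y. \<Sum>i<a. \<Sum>j<b. A $$ (i, j) * x i * y j"
      have le: "?B x y \<le> op_norm A * (1 / 4)" if "L2_set x {..<a} * L2_set y {..<b} \<le> 1 / 4" for x y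
      proof -
        have "?B x y \<le> op_norm A * (L2_set x {..<a} * L2_set y {..<b})"
          using bilinear_le_op_norm[OF A, of x y] by (simp add: mult_ac)
        also have "\<dots> \<le> op_norm A * (1 / 4)"
          by (intro mult_left_mono that op_norm_nonneg[OF A])
        finally show ?thesis .
      qed
      have "?B x y = ?B (net_vector a w) (net_vector b v) + ?B (\<lambda>i. x i - net_vector a w i) y
          + ?B (net_vector a w) (\<lambda>j. y j - net_vector b v j)"
        unfolding sum.distrib[symmetric] by (intro sum.cong refl) (simp add: algebra_simps)
      also have "\<dots> \<le> t + op_norm A * (1 / 4) + op_norm A * (1 / 4)"
      proof (intro add_mono net w v le)
        show "L2_set (\<lambda>i. x i - net_vector a w i) {..<a} * L2_set y {..<b} \<le> 1 / 4"
          using w y by simp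
        have "L2_set (net_vector a w) {..<a} * L2_set (\<lambda>j. y j - net_vector b v j) {..<b} \<le> 1 * (1 / 4)"
          by (intro mult_mono wn v) auto
        then show "L2_set (net_vector a w) {..<a} * L2_set (\<lambda>j. y j - net_vector b v j) {..<b} \<le> 1 / 4"
          by simp
      qed
      finally show "?B x y \<le> t + op_norm A / 2" by simp
    qed
    then have "op_norm A \<le> 2 * t" by simp
    also have "2 * t = sqrt (152 * real (a + b))"
      unfolding t_def by (rule real_sqrt_unique[symmetric]) (auto simp: power_mult_distrib)
    finally have "op_norm A * (L2_set x {..<a} * L2_set y {..<b})
        \<le> sqrt (152 * real (a + b)) * (L2_set x {..<a} * L2_set y {..<b})"
      by (intro mult_right_mono) auto
    then show ?thesis
      using bilinear_le_op_norm[OF A, of x y] unfolding AJ by (simp add: mult_ac)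
  qed
  with cG show ?thesis by (intro exI[of _ "?X - Bad"]) auto
qed

section \<open>Hidden signs and local oracles\<close>

text \<open>An index in \<open>I\<close> stands for one hidden sign, and \<open>pos\<close> places
  it in the matrix. The separate index type lets the patterns be organised by blocks later
  on.\<close>

locale hard_family =
  fixes m n :: nat and G \<delta> :: real and I :: "'i set" and pos :: "'i \<Rightarrow> nat \<times> nat"
  assumes finI: "finite I" and neI: "I \<noteq> {}"
    and pos: "e \<in> I \<Longrightarrow> pos e \<in> {..<m} \<times> {..<n}"
    and G: "0 < G" and \<delta>: "0 < \<delta>"
begin

definition piece :: "('i \<Rightarrow> real) \<Rightarrow> ('i \<Rightarrow> nat) \<Rightarrow> 'i \<Rightarrow> real mat \<Rightarrow> real" where
  "piece \<xi> s e W = G * (\<xi> e * W $$ pos e) - \<delta> * real (s e)"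

text \<open>The larger of the two values that the piece of \<open>e\<close> can take at
  \<open>W\<close>, over both choices of its sign.\<close>

definition cap :: "('i \<Rightarrow> nat) \<Rightarrow> 'i \<Rightarrow> real mat \<Rightarrow> real" where
  "cap s e W = G * \<bar>W $$ pos e\<bar> - \<delta> * real (s e)"

definition hardf :: "('i \<Rightarrow> real) \<Rightarrow> ('i \<Rightarrow> nat) \<Rightarrow> real mat \<Rightarrow> real" where
  "hardf \<xi> s = (\<lambda>W\<in>carrier_mat m n. MAX e\<in>I. piece \<xi> s e W)"

definition signs :: "('i \<Rightarrow> real) set" where
  "signs = PiE I (\<lambda>_. {-1, 1})"

lemma signs_cases: "\<xi> \<in> signs \<Longrightarrow> e \<in> I \<Longrightarrow> \<xi> e = 1 \<or> \<xi> e = -1"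
  by (auto simp: signs_def)

lemma signs_abs: "\<xi> \<in> signs \<Longrightarrow> e \<in> I \<Longrightarrow> \<bar>\<xi> e\<bar> = 1"
  using signs_cases by fastforce

lemma piece_le_cap:
  assumes "\<xi> \<in> signs" "e \<in> I"
  shows "piece \<xi> s e W \<le> cap s e W"
proof -
  have "\<xi> e * W $$ pos e \<le> \<bar>\<xi> e * W $$ pos e\<bar>" by simp
  also have "\<dots> = \<bar>W $$ pos e\<bar>" by (simp add: abs_mult signs_abs[OF assms])
  finally show ?thesis using G by (simp add: piece_def cap_def)
qed

lemma piece_le_hardf: "W \<in> carrier_mat m n \<Longrightarrow> e \<in> I \<Longrightarrow> piece \<xi> s e W \<le> hardf \<xi> s W"
  using finI by (auto simp: hardf_def)

lemma hardf_attained: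
  assumes "W \<in> carrier_mat m n"
  obtains e where "e \<in> I" "hardf \<xi> s W = piece \<xi> s e W"
proof -
  have "(MAX e\<in>I. piece \<xi> s e W) \<in> (\<lambda>e. piece \<xi> s e W) ` I"
    using finI neI by (intro Max_in) auto
  then show ?thesis using that assms by (auto simp: hardf_def)
qed

lemma piece_Lipschitz:
  assumes "\<xi> \<in> signs" "e \<in> I" "V \<in> carrier_mat m n" "W \<in> carrier_mat m n"
  shows "piece \<xi> s e V \<le> piece \<xi> s e W + G * \<bar>V $$ pos e - W $$ pos e\<bar>"
proof -
  have "\<xi> e * V $$ pos e - \<xi> e * W $$ pos e \<le> \<bar>\<xi> e * (V $$ pos e - W $$ pos e)\<bar>"
    by (simp add: algebra_simps)
  also have "\<dots> = \<bar>V $$ pos e - W $$ pos e\<bar>"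
    by (simp add: abs_mult signs_abs[OF assms(1,2)])
  finally have "G * (\<xi> e * V $$ pos e - \<xi> e * W $$ pos e) \<le> G * \<bar>V $$ pos e - W $$ pos e\<bar>"
    using G by (intro mult_left_mono) auto
  then show ?thesis by (simp add: piece_def algebra_simps)
qed

text \<open>A maximum of affine functions with slope \<open>G\<close> in one entry each, and an
  entry is bounded by the operator norm. The Lipschitz bound holds on the whole space, so any radius
  \<open>R\<close> is allowed.\<close>

lemma hardf_in_op_class:
  assumes \<xi>: "\<xi> \<in> signs"
  shows "hardf \<xi> s \<in> op_class m n G R"
proof -
  interpret Metric_space "carrier_mat m n" "frob_dist m n" by (rule Metric_space_frob_dist)
  have "convex_fun m n (hardf \<xi> s)"
    unfolding convex_fun_def
  proof (intro ballI)
    fix V W :: "real mat" and t :: real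
    assume V: "V \<in> carrier_mat m n" and W: "W \<in> carrier_mat m n" and t: "t \<in> {0..1}"
    let ?U = "(1 - t) \<cdot>\<^sub>m V + t \<cdot>\<^sub>m W"
    have U: "?U \<in> carrier_mat m n" using V W by simp
    obtain e where e: "e \<in> I" "hardf \<xi> s ?U = piece \<xi> s e ?U"
      using hardf_attained[OF U] .
    have "piece \<xi> s e ?U = (1 - t) * piece \<xi> s e V + t * piece \<xi> s e W"
      using pos[OF e(1)] V W by (auto simp: piece_def algebra_simps)
    also have "\<dots> \<le> (1 - t) * hardf \<xi> s V + t * hardf \<xi> s W"
      using t by (intro add_mono mult_left_mono piece_le_hardf V W e) auto
    finally show "hardf \<xi> s ?U \<le> (1 - t) * hardf \<xi> s V + t * hardf \<xi> s W" using e by simp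
  qed
  moreover have "op_lipschitz_on G (carrier_mat m n) (hardf \<xi> s)"
  proof -
    have le: "hardf \<xi> s V - hardf \<xi> s W \<le> G * op_norm (V - W)"
      if V: "V \<in> carrier_mat m n" and W: "W \<in> carrier_mat m n" for V W
    proof -
      obtain e where e: "e \<in> I" "hardf \<xi> s V = piece \<xi> s e V"
        using hardf_attained[OF V] .
      have "(V - W) \<in> carrier_mat m n" using W by (rule minus_carrier_mat)
      from abs_entry_le_op_norm[OF this, of "fst (pos e)" "snd (pos e)"]
      have "\<bar>V $$ pos e - W $$ pos e\<bar> \<le> op_norm (V - W)"
        using pos[OF e(1)] V W by (cases "pos e") auto
      then have "G * \<bar>V $$ pos e - W $$ pos e\<bar> \<le> G * op_norm (V - W)"
        using G by simp
      then show ?thesis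
        using piece_Lipschitz[OF \<xi> e(1) V W, of s] piece_le_hardf[OF W e(1), of \<xi> s] e(2) by linarith
    qed
    have sym: "op_norm (V - W) = op_norm (W - V)"
      if V: "V \<in> carrier_mat m n" and W: "W \<in> carrier_mat m n" for V W
    proof -
      have "op_norm (V - W) \<le> op_norm (W - V)"
        if V: "V \<in> carrier_mat m n" and W: "W \<in> carrier_mat m n" for V W
      proof (rule op_norm_leI)
        show "V - W \<in> carrier_mat m n" using W by (rule minus_carrier_mat)
        have WV: "W - V \<in> carrier_mat m n" using V by (rule minus_carrier_mat)
        then show "0 \<le> op_norm (W - V)" by (rule op_norm_nonneg)
        fix x y :: "nat \<Rightarrow> real"
        have "(\<Sum>i<m. \<Sum>j<n. (V - W) $$ (i, j) * x i * y j)
            = (\<Sum>i<m. \<Sum>j<n. (W - V) $$ (i, j) * (- x i) * y j)"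
          using V W by (intro sum.cong refl) (simp add: algebra_simps)
        also have "\<dots> \<le> op_norm (W - V) * L2_set (\<lambda>i. - x i) {..<m} * L2_set y {..<n}"
          by (rule bilinear_le_op_norm[OF WV])
        finally show "(\<Sum>i<m. \<Sum>j<n. (V - W) $$ (i, j) * x i * y j)
            \<le> op_norm (W - V) * L2_set x {..<m} * L2_set y {..<n}"
          by (simp add: L2_set_def)
      qed
      then show ?thesis using V W by (intro antisym) auto
    qed
    show ?thesis
      unfolding op_lipschitz_on_def abs_le_iff
    proof (intro ballI conjI)
      fix V W :: "real mat" assume VW: "V \<in> carrier_mat m n" "W \<in> carrier_mat m n"
      show "hardf \<xi> s V - hardf \<xi> s W \<le> G * op_norm (V - W)" by (rule le[OF VW])
      show "- (hardf \<xi> s V - hardf \<xi> s W) \<le> G * op_norm (V - W)"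
        using le[OF VW(2,1)] sym[OF VW] by simp
    qed
  qed
  moreover have "openin (mat_topology m n) (carrier_mat m n)"
    using openin_topspace[of mtopology] by (simp add: mat_topology_def)
  moreover have "op_ball m n R \<subseteq> carrier_mat m n" by (auto simp: op_ball_def)
  ultimately show ?thesis
    unfolding op_class_def by (auto simp: hardf_def)
qed

text \<open>The pieces that differ lie, whatever their sign, strictly below the value at
  \<open>X\<close>. Near \<open>X\<close> they stay below the shared piece that attains it, so
  neither maximum notices them.\<close>

lemma hardf_agree_near:
  assumes \<xi>: "\<xi> \<in> signs" "\<xi>' \<in> signs" and X: "X \<in> carrier_mat m n"
    and eq: "\<And>e. e \<in> I \<Longrightarrow> (\<xi> e = \<xi>' e \<and> s e = s' e) \<or>
      (cap s e X < hardf \<xi> s X \<and> cap s' e X < hardf \<xi> s X)"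
  shows "\<exists>U. openin (mat_topology m n) U \<and> X \<in> U \<and> (\<forall>V\<in>U. hardf \<xi> s V = hardf \<xi>' s' V)"
proof -
  interpret Metric_space "carrier_mat m n" "frob_dist m n" by (rule Metric_space_frob_dist)
  let ?f = "hardf \<xi> s X"
  \<comment> \<open>Shared pieces get the dummy gap 1, so that the minimum \<open>\<rho>\<close>
    over all of \<open>I\<close> is positive.\<close>
  let ?gap = "\<lambda>e. if \<xi> e = \<xi>' e \<and> s e = s' e then 1 else ?f - max (cap s e X) (cap s' e X)"
  define \<rho> where "\<rho> = Min (?gap ` I)"
  have "\<rho> \<in> ?gap ` I" unfolding \<rho>_def by (intro Min_in finite_imageI finI) (use neI in blast)
  moreover have "\<forall>e\<in>I. 0 < ?gap e" using eq by fastforce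
  ultimately have \<rho>: "0 < \<rho>" by blast
  have gap: "cap s e X \<le> ?f - \<rho>" "cap s' e X \<le> ?f - \<rho>" if "e \<in> I" "\<not> (\<xi> e = \<xi>' e \<and> s e = s' e)" for e
  proof -
    have "\<rho> \<le> ?gap e" unfolding \<rho>_def using that finI by (intro Min_le) auto
    with that(2) show "cap s e X \<le> ?f - \<rho>" "cap s' e X \<le> ?f - \<rho>" by (simp_all split: if_splits)
  qed
  define r where "r = \<rho> / (4 * G)"
  have r: "0 < r" "G * r = \<rho> / 4" using \<rho> G by (auto simp: r_def)
  obtain e0 where e0: "e0 \<in> I" "?f = piece \<xi> s e0 X" using hardf_attained[OF X] .
  \<comment> \<open>A piece with value \<open>?f\<close> at \<open>X\<close> has cap at least
    \<open>?f\<close>, so it is not among those that differ.\<close>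
  have e0s: "\<xi> e0 = \<xi>' e0 \<and> s e0 = s' e0"
  proof (rule ccontr)
    assume "\<not> ?thesis"
    from gap(1)[OF e0(1) this] piece_le_cap[OF \<xi>(1) e0(1), of s X] e0(2) \<rho> show False by linarith
  qed
  have "hardf \<xi> s V = hardf \<xi>' s' V" if V: "V \<in> mball X r" for V
  proof -
    have Vc: "V \<in> carrier_mat m n" using V by simp
    have near: "G * \<bar>V $$ pos e - X $$ pos e\<bar> \<le> \<rho> / 4" if "e \<in> I" for e
    proof -
      have "\<bar>X $$ pos e - V $$ pos e\<bar> \<le> frob_dist m n X V"
        using member_le_L2_set[of "{..<m} \<times> {..<n}" "pos e" "\<lambda>ij. \<bar>X $$ ij - V $$ ij\<bar>"] pos[OF that]
        by (simp add: frob_dist_def L2_set_def)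
      also have "\<dots> \<le> r" using V by simp
      finally have "G * \<bar>V $$ pos e - X $$ pos e\<bar> \<le> G * r" using G by (simp add: abs_minus_commute)
      then show ?thesis using r by simp
    qed
    have top: "?f - \<rho> / 4 \<le> piece \<xi> s e0 V" "piece \<xi>' s' e0 V = piece \<xi> s e0 V"
      using piece_Lipschitz[OF \<xi>(1) e0(1) X Vc, of s] near[OF e0(1)] e0 e0s
      by (auto simp: piece_def abs_minus_commute)
    have low: "piece \<zeta> u e V \<le> ?f - \<rho> / 2" if "\<zeta> \<in> signs" "e \<in> I" "cap u e X \<le> ?f - \<rho>" for \<zeta> u e
      using piece_Lipschitz[OF that(1,2) Vc X, of u] near[OF that(2)] piece_le_cap[OF that(1,2), of u X]
        that(3) \<rho> by linarith
    have "piece \<xi> s e V \<le> hardf \<xi>' s' V \<and> piece \<xi>' s' e V \<le> hardf \<xi> s V" if e: "e \<in> I" for e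
    proof (cases "\<xi> e = \<xi>' e \<and> s e = s' e")
      case True
      then have "piece \<xi> s e V = piece \<xi>' s' e V" by (simp add: piece_def)
      then show ?thesis using piece_le_hardf[OF Vc e, of \<xi> s] piece_le_hardf[OF Vc e, of \<xi>' s'] by simp
    next
      case False
      show ?thesis
        using low[OF \<xi>(1) e gap(1)[OF e False]] low[OF \<xi>(2) e gap(2)[OF e False]] top \<rho>
          piece_le_hardf[OF Vc e0(1), of \<xi> s] piece_le_hardf[OF Vc e0(1), of \<xi>' s'] by linarith
    qed
    then show ?thesis
      using hardf_attained[OF Vc, of \<xi> s] hardf_attained[OF Vc, of \<xi>' s'] by (metis antisym)
  qed
  then show ?thesis
    using r X by (intro exI[of _ "mball X r"]) (auto simp: mat_topology_def)
qed

end

section \<open>Continued runs, agreements and ties\<close>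

locale hard_run = hard_family m n G \<delta> I pos
  for m n :: nat and G \<delta> :: real and I :: "'i set" and pos :: "'i \<Rightarrow> nat \<times> nat" +
  fixes R :: real and orc :: oracle_map and A :: algorithm
  assumes local: "local_oracle m n (op_class m n G R) orc" and A: "A \<in> algorithms m n"
begin

text \<open>The run is continued past a decision to stop, with the output as a further query.\<close>

primrec run :: "('i \<Rightarrow> real) \<Rightarrow> ('i \<Rightarrow> nat) \<Rightarrow> nat \<Rightarrow> transcript" where
  "run \<xi> s 0 = []"
| "run \<xi> s (Suc q) = run \<xi> s q @ [(point (A (run \<xi> s q)), orc (hardf \<xi> s) (point (A (run \<xi> s q))))]"

definition qry :: "('i \<Rightarrow> real) \<Rightarrow> ('i \<Rightarrow> nat) \<Rightarrow> nat \<Rightarrow> real mat" where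
  "qry \<xi> s q = point (A (run \<xi> s q))"

definition processed :: "('i \<Rightarrow> real) \<Rightarrow> ('i \<Rightarrow> nat) \<Rightarrow> nat \<Rightarrow> 'i set" where
  "processed \<xi> s q = {e \<in> I. \<exists>r<q. hardf \<xi> s (qry \<xi> s r) \<le> cap s e (qry \<xi> s r)}"

text \<open>The sign at which the piece of \<open>e\<close> meets its cap at \<open>X\<close>. At a
  zero entry both signs do, and 1 is a convention.\<close>

definition guess :: "real mat \<Rightarrow> 'i \<Rightarrow> real" where
  "guess X e = (if 0 \<le> X $$ pos e then 1 else -1)"

text \<open>The agreements among the queries 0 to \<open>Q\<close>. This set is the code word from
  which, given the shifts, the signs of a solved instance are recovered.\<close>

definition matched :: "nat \<Rightarrow> ('i \<Rightarrow> real) \<Rightarrow> ('i \<Rightarrow> nat) \<Rightarrow> 'i set" where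
  "matched Q \<xi> s = {e \<in> I. \<exists>r\<le>Q. e \<notin> processed \<xi> s r \<and> e \<in> processed \<xi> s (Suc r) \<and>
     \<xi> e = guess (qry \<xi> s r) e}"

text \<open>Asymmetric in \<open>e\<close> and \<open>e'\<close>: the unprocessed piece stands on
  one side only, so that for \<open>e' \<noteq> e\<close> and all other shifts fixed the equation
  determines \<open>s e\<close>.\<close>

definition tie :: "('i \<Rightarrow> real) \<Rightarrow> ('i \<Rightarrow> nat) \<Rightarrow> nat \<Rightarrow> 'i \<Rightarrow> 'i \<Rightarrow> bool" where
  "tie \<xi> s r e e' \<longleftrightarrow> e \<notin> processed \<xi> s r \<and> cap s e (qry \<xi> s r) = piece \<xi> s e' (qry \<xi> s r)"

text \<open>Queries are numbered from 0, so an output after \<open>Q\<close> oracle calls is the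
  query of index \<open>Q\<close> in the continued run and is included.\<close>

definition solved :: "nat \<Rightarrow> real \<Rightarrow> ('i \<Rightarrow> real) \<Rightarrow> ('i \<Rightarrow> nat) \<Rightarrow> bool" where
  "solved Q \<gamma> \<xi> s \<longleftrightarrow> (\<exists>q\<le>Q. hardf \<xi> s (qry \<xi> s q) \<le> - \<gamma>)"

lemma qry_carrier: "qry \<xi> s q \<in> carrier_mat m n"
  using A by (simp add: algorithms_def qry_def)

lemma processed_mono: "q \<le> q' \<Longrightarrow> processed \<xi> s q \<subseteq> processed \<xi> s q'"
  unfolding processed_def by (blast intro: less_le_trans)

lemma processed_subset: "processed \<xi> s q \<subseteq> I"
  by (auto simp: processed_def)

lemma orc_agree:
  assumes "\<xi> \<in> signs" "\<xi>' \<in> signs" "X \<in> carrier_mat m n"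
    and "\<And>e. e \<in> I \<Longrightarrow> (\<xi> e = \<xi>' e \<and> s e = s' e) \<or>
      (cap s e X < hardf \<xi> s X \<and> cap s' e X < hardf \<xi> s X)"
  shows "orc (hardf \<xi> s) X = orc (hardf \<xi>' s') X"
  by (rule local[unfolded local_oracle_def, rule_format, OF
      hardf_in_op_class[OF assms(1)] hardf_in_op_class[OF assms(2)] assms(3) hardf_agree_near[OF assms]])

text \<open>Equal transcripts give equal queries, and by locality the answers agree as long as the
  differing pieces stay strictly below the maximum.\<close>

lemma run_agree:
  assumes \<xi>: "\<xi> \<in> signs" "\<xi>' \<in> signs"
    and eq: "\<And>e. e \<in> I \<Longrightarrow> (\<xi> e = \<xi>' e \<and> s e = s' e) \<or>
      (\<forall>j<q. cap s e (qry \<xi> s j) < hardf \<xi> s (qry \<xi> s j) \<and> cap s' e (qry \<xi> s j) < hardf \<xi> s (qry \<xi> s j))"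
  shows "run \<xi>' s' q = run \<xi> s q"
  using eq
proof (induction q)
  case (Suc q)
  have IH: "run \<xi>' s' q = run \<xi> s q"
    using Suc.prems by (intro Suc.IH) (meson less_SucI)
  have "orc (hardf \<xi> s) (qry \<xi> s q) = orc (hardf \<xi>' s') (qry \<xi> s q)"
    using Suc.prems by (intro orc_agree \<xi> qry_carrier) blast
  then show ?case using IH by (simp add: qry_def)
qed simp

text \<open>As long as the piece of \<open>e\<close> is unprocessed, the run does not depend on the shift of \<open>e\<close>, so
  a tie pins that shift down.\<close>

lemma tie_shift_unique:
  assumes \<xi>: "\<xi> \<in> signs" and "e \<in> I" "e' \<in> I" "e' \<noteq> e" and off: "\<And>d. d \<in> I \<Longrightarrow> d \<noteq> e \<Longrightarrow> s d = s' d"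
    and tie: "tie \<xi> s r e e'" "tie \<xi> s' r e e'"
  shows "s e = s' e"
proof -
  \<comment> \<open>The instance with the smaller shift of \<open>e\<close> is the reference: a
    larger shift only lowers the cap, so where the cap for \<open>s\<close> is below the maximum,
    that for \<open>s'\<close> is too.\<close>
  have *: "s e = s' e" if le: "s e \<le> s' e" and off: "\<And>d. d \<in> I \<Longrightarrow> d \<noteq> e \<Longrightarrow> s d = s' d"
    and tie: "tie \<xi> s r e e'" "tie \<xi> s' r e e'" for s s'
  proof -
    have "run \<xi> s' r = run \<xi> s r"
    proof (rule run_agree[OF \<xi> \<xi>])
      fix d assume d: "d \<in> I"
      show "\<xi> d = \<xi> d \<and> s d = s' d \<or> (\<forall>j<r. cap s d (qry \<xi> s j) < hardf \<xi> s (qry \<xi> s j)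
          \<and> cap s' d (qry \<xi> s j) < hardf \<xi> s (qry \<xi> s j))"
      proof (cases "d = e")
        case True
        have lt: "cap s e (qry \<xi> s j) < hardf \<xi> s (qry \<xi> s j)" if "j < r" for j
          using tie(1) that \<open>e \<in> I\<close> by (auto simp: tie_def processed_def not_le)
        have cap: "cap s' e X \<le> cap s e X" for X
          using le \<delta> by (simp add: cap_def mult_left_mono)
        have "cap s' e (qry \<xi> s j) < hardf \<xi> s (qry \<xi> s j)" if "j < r" for j
          by (rule le_less_trans[OF cap lt[OF that]])
        with lt True show ?thesis by simp
      next
        case False
        with off[OF d] show ?thesis by blast
      qed
    qed
    then have q: "qry \<xi> s' r = qry \<xi> s r" by (simp add: qry_def)
    have "piece \<xi> s e' X = piece \<xi> s' e' X" for X
      unfolding piece_def off[OF \<open>e' \<in> I\<close> \<open>e' \<noteq> e\<close>] ..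
    then have "cap s e (qry \<xi> s r) = cap s' e (qry \<xi> s r)"
      using tie q by (simp add: tie_def)
    then show ?thesis using \<delta> by (simp add: cap_def)
  qed
  show ?thesis
  proof (cases "s e \<le> s' e")
    case True
    then show ?thesis by (rule *[OF _ off tie])
  next
    case False
    then have "s' e \<le> s e" by simp
    then have "s' e = s e" by (rule *[OF _ off[symmetric] tie(2,1)])
    then show ?thesis by simp
  qed
qed

text \<open>\<open>processed\<close> grows, so an index enters it at one query only, and membership
  in \<open>matched\<close> is decided there.\<close>

lemma matched_iff:
  assumes "e \<in> I" "r \<le> Q" "e \<notin> processed \<xi> s r" "e \<in> processed \<xi> s (Suc r)"
  shows "e \<in> matched Q \<xi> s \<longleftrightarrow> \<xi> e = guess (qry \<xi> s r) e"
proof -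
  have "r' = r" if "e \<notin> processed \<xi> s r'" "e \<in> processed \<xi> s (Suc r')" for r'
  proof (rule ccontr)
    assume "r' \<noteq> r"
    then have "Suc r' \<le> r \<or> Suc r \<le> r'" by linarith
    then show False
      using that assms processed_mono[of "Suc r'" r \<xi> s] processed_mono[of "Suc r" r' \<xi> s] by blast
  qed
  note unique = this
  show ?thesis
  proof
    assume "e \<in> matched Q \<xi> s"
    then obtain r' where r': "e \<notin> processed \<xi> s r'" "e \<in> processed \<xi> s (Suc r')"
        "\<xi> e = guess (qry \<xi> s r') e"
      unfolding matched_def by blast
    with unique[OF r'(1,2)] show "\<xi> e = guess (qry \<xi> s r) e" by simp
  next
    assume "\<xi> e = guess (qry \<xi> s r) e"
    with assms show "e \<in> matched Q \<xi> s" unfolding matched_def by blast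
  qed
qed

lemma guess_eq_iff_eq:
  assumes "\<xi> \<in> signs" "\<xi>' \<in> signs" "e \<in> I" "\<xi> e = guess X e \<longleftrightarrow> \<xi>' e = guess X e"
  shows "\<xi> e = \<xi>' e"
  using signs_cases[OF assms(1,3)] signs_cases[OF assms(2,3)] assms(4) by (auto simp: guess_def split: if_splits)

lemma mem_processed_Suc:
  "e \<in> processed \<xi> s (Suc q) \<longleftrightarrow> e \<in> processed \<xi> s q \<or> (e \<in> I \<and> hardf \<xi> s (qry \<xi> s q) \<le> cap s e (qry \<xi> s q))"
  by (auto simp: processed_def less_Suc_eq)

text \<open>A sign is revealed when its piece is processed, and the run up to that query only depends
  on the signs processed before.\<close>

lemma matched_determines_run:
  assumes \<xi>: "\<xi> \<in> signs" "\<xi>' \<in> signs" and eq: "matched Q \<xi> s = matched Q \<xi>' s" and "q \<le> Suc Q"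
  shows "run \<xi>' s q = run \<xi> s q \<and> processed \<xi>' s q = processed \<xi> s q \<and>
    (\<forall>e\<in>processed \<xi> s q. \<xi> e = \<xi>' e)"
  using \<open>q \<le> Suc Q\<close>
proof (induction q)
  case 0
  then show ?case by (simp add: processed_def)
next
  case (Suc q)
  then have IH: "run \<xi>' s q = run \<xi> s q" "processed \<xi>' s q = processed \<xi> s q"
    "\<And>e. e \<in> processed \<xi> s q \<Longrightarrow> \<xi> e = \<xi>' e" and q: "q \<le> Q" by auto
  define X where "X = qry \<xi> s q"
  have X: "X \<in> carrier_mat m n" "qry \<xi> s q = X" "qry \<xi>' s q = X"
    using IH(1) by (simp_all add: X_def qry_carrier) (simp add: qry_def)
  \<comment> \<open>The two maxima at \<open>X\<close> agree. A piece attaining the larger one would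
    have different signs in the two instances, hence be unprocessed in both so far and become
    processed in both at this query; equal \<open>matched\<close> sets then force equal signs. The
    claim is generic because both directions are used.\<close>
  have no: "\<not> hardf \<zeta>' s X < hardf \<zeta> s X"
    if \<zeta>: "\<zeta> \<in> signs" "\<zeta>' \<in> signs" "matched Q \<zeta> s = matched Q \<zeta>' s" "processed \<zeta>' s q = processed \<zeta> s q"
      "\<And>e. e \<in> processed \<zeta> s q \<Longrightarrow> \<zeta> e = \<zeta>' e" "qry \<zeta> s q = X" "qry \<zeta>' s q = X" for \<zeta> \<zeta>'
  proof
    assume less: "hardf \<zeta>' s X < hardf \<zeta> s X"
    obtain e where e: "e \<in> I" "hardf \<zeta> s X = piece \<zeta> s e X" using hardf_attained[OF X(1)] .
    have "piece \<zeta>' s e X \<noteq> piece \<zeta> s e X" using piece_le_hardf[OF X(1) e(1), of \<zeta>' s] less e by simp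
    then have ne: "\<zeta> e \<noteq> \<zeta>' e" by (auto simp: piece_def)
    then have new: "e \<notin> processed \<zeta> s q" "e \<notin> processed \<zeta>' s q" using \<zeta> by auto
    have "hardf \<zeta> s X \<le> cap s e X" using piece_le_cap[OF \<zeta>(1) e(1), of s X] e by simp
    then have "e \<in> processed \<zeta> s (Suc q)" "e \<in> processed \<zeta>' s (Suc q)"
      using less e \<zeta> by (auto simp: mem_processed_Suc)
    then have "\<zeta> e = guess X e \<longleftrightarrow> \<zeta>' e = guess X e"
      using matched_iff[OF e(1) q new(1)] matched_iff[OF e(1) q new(2)] \<zeta> by simp
    with ne guess_eq_iff_eq[OF \<zeta>(1,2) e(1)] show False by blast
  qed
  have "\<not> hardf \<xi>' s X < hardf \<xi> s X"
    by (rule no[OF \<xi> eq IH(2) _ X(2,3)]) (rule IH(3))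
  moreover have "\<not> hardf \<xi> s X < hardf \<xi>' s X"
    by (rule no[OF \<xi>(2,1) eq[symmetric] IH(2)[symmetric] _ X(3,2)]) (simp add: IH)
  ultimately have f: "hardf \<xi>' s X = hardf \<xi> s X" by linarith
  have P: "processed \<xi>' s (Suc q) = processed \<xi> s (Suc q)"
    using IH f X by (auto simp: mem_processed_Suc)
  have S: "\<xi> e = \<xi>' e" if e: "e \<in> processed \<xi> s (Suc q)" for e
  proof (cases "e \<in> processed \<xi> s q")
    case False
    have eI: "e \<in> I" using e processed_subset by blast
    have "\<xi> e = guess X e \<longleftrightarrow> \<xi>' e = guess X e"
      using matched_iff[OF eI q False e] matched_iff[OF eI q, of \<xi>' s] False e P IH X eq by simp
    then show ?thesis by (rule guess_eq_iff_eq[OF \<xi> eI])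
  qed (rule IH)
  have "orc (hardf \<xi> s) X = orc (hardf \<xi>' s) X"
  proof (rule orc_agree[OF \<xi> X(1)])
    fix e assume "e \<in> I"
    then show "\<xi> e = \<xi>' e \<and> s e = s e \<or> cap s e X < hardf \<xi> s X \<and> cap s e X < hardf \<xi> s X"
      using S[of e] X by (auto simp: mem_processed_Suc not_le)
  qed
  then have "run \<xi>' s (Suc q) = run \<xi> s (Suc q)"
    using IH(1) by (simp add: X_def qry_def)
  with P S show ?case by blast
qed

section \<open>Counting the solved instances\<close>

text \<open>All caps are at least \<open>- \<delta> * L \<ge> - \<gamma>\<close>, so a query of
  value at most \<open>- \<gamma>\<close> processes every piece.\<close>

lemma solved_processed:
  assumes "solved Q \<gamma> \<xi> s" and s: "s \<in> PiE I (\<lambda>_. {..<L})" and L: "\<delta> * real L \<le> \<gamma>"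
  shows "processed \<xi> s (Suc Q) = I"
proof -
  obtain q where q: "q \<le> Q" "hardf \<xi> s (qry \<xi> s q) \<le> - \<gamma>" using assms by (auto simp: solved_def)
  have "hardf \<xi> s (qry \<xi> s q) \<le> cap s e (qry \<xi> s q)" if "e \<in> I" for e
  proof -
    have "\<delta> * real (s e) \<le> \<delta> * real L" using PiE_mem[OF s that] \<delta> by (intro mult_left_mono) auto
    moreover have "0 \<le> G * \<bar>qry \<xi> s q $$ pos e\<bar>" using G by simp
    ultimately show ?thesis using q L by (simp add: cap_def)
  qed
  then show ?thesis using q by (auto simp: processed_def less_Suc_eq_le)
qed

text \<open>Two agreements at one query would both attain the maximum and hence tie, so there is at
  most one per query. The query that solves the instance contributes none, which gives
  \<open>Q\<close> and not \<open>Q + 1\<close>.\<close>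

lemma card_matched_le:
  assumes \<xi>: "\<xi> \<in> signs" and solved: "solved Q \<gamma> \<xi> s" and s: "s \<in> PiE I (\<lambda>_. {..<L})"
    and L: "\<delta> * real L \<le> \<gamma>"
    and notie: "\<And>r e e'. r \<le> Q \<Longrightarrow> e \<in> I \<Longrightarrow> e' \<in> I \<Longrightarrow> e' \<noteq> e \<Longrightarrow> \<not> tie \<xi> s r e e'"
  shows "card (matched Q \<xi> s) \<le> Q"
proof -
  obtain q where q: "q \<le> Q" "hardf \<xi> s (qry \<xi> s q) \<le> - \<gamma>" using solved by (auto simp: solved_def)
  have all: "processed \<xi> s (Suc q) = I"
    by (rule solved_processed[OF _ s L]) (use q in \<open>auto simp: solved_def\<close>)
  define M where "M r = {e \<in> I. e \<notin> processed \<xi> s r \<and> e \<in> processed \<xi> s (Suc r) \<and>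
    \<xi> e = guess (qry \<xi> s r) e}" for r
  have piece: "piece \<xi> s e (qry \<xi> s r) = cap s e (qry \<xi> s r)" if "e \<in> M r" for e r
    using that by (auto simp: M_def guess_def piece_def cap_def)
  have "matched Q \<xi> s \<subseteq> (\<Union>r<q. M r)"
  proof
    fix e assume "e \<in> matched Q \<xi> s"
    then obtain r where r: "e \<in> M r" "e \<in> I" by (auto simp: matched_def M_def)
    have "r \<le> q"
    proof (rule ccontr)
      assume "\<not> r \<le> q"
      then have "processed \<xi> s (Suc q) \<subseteq> processed \<xi> s r" by (intro processed_mono) simp
      then show False using r all by (auto simp: M_def)
    qed
    \<comment> \<open>At the solving query an agreement would have as value its cap, which exceeds
      \<open>- \<delta> * L \<ge> - \<gamma>\<close> because \<open>s e < L\<close>, while the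
      maximum is at most \<open>- \<gamma>\<close>.\<close>
    moreover have "r \<noteq> q"
    proof
      assume "r = q"
      have "piece \<xi> s e (qry \<xi> s q) \<le> - \<gamma>"
        using piece_le_hardf[OF qry_carrier r(2), of \<xi> s \<xi> s q] q by simp
      moreover have "\<delta> * real (s e) < \<delta> * real L" using s r(2) \<delta> by (intro mult_strict_left_mono) auto
      moreover have "0 \<le> G * \<bar>qry \<xi> s q $$ pos e\<bar>" using G by simp
      ultimately show False using piece[OF r(1)] L \<open>r = q\<close> by (simp add: cap_def)
    qed
    ultimately show "e \<in> (\<Union>r<q. M r)" using r by auto
  qed
  then have "card (matched Q \<xi> s) \<le> card (\<Union>r<q. M r)"
    using finI by (intro card_mono finite_UN_I) (auto simp: M_def)
  also have "\<dots> \<le> (\<Sum>r<q. card (M r))" by (rule card_UN_le) simp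
  also have "\<dots> \<le> (\<Sum>r<q. 1)"
  proof (intro sum_mono)
    fix r assume "r \<in> {..<q}"
    then have r: "r \<le> Q" using q by simp
    have "e = e'" if e: "e \<in> M r" "e' \<in> M r" for e e'
    proof (rule ccontr)
      assume ne: "e \<noteq> e'"
      let ?X = "qry \<xi> s r"
      have eI: "e \<in> I" "e' \<in> I" "e \<notin> processed \<xi> s r" using e by (auto simp: M_def)
      have "hardf \<xi> s ?X \<le> cap s d ?X" if "d \<in> M r" for d
        using that by (auto simp: M_def mem_processed_Suc)
      then have "cap s d ?X = hardf \<xi> s ?X" if "d \<in> M r" for d
        using that piece[OF that] piece_le_hardf[OF qry_carrier, of d \<xi> s \<xi> s r]
        by (auto simp: M_def intro!: antisym)
      then have "tie \<xi> s r e e'"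
        using e eI piece by (simp add: tie_def)
      then show False using notie[OF r eI(1,2)] ne by blast
    qed
    then show "card (M r) \<le> 1"
      using finI by (auto simp: card_le_Suc0_iff_eq M_def)
  qed
  also have "\<dots> \<le> Q" using q by simp
  finally show ?thesis .
qed

lemma finite_signs: "finite signs"
  unfolding signs_def using finI by (intro finite_PiE) auto

lemma card_signs: "card signs = 2 ^ card I"
  unfolding signs_def using finI by (simp add: card_PiE numeral_2_eq_2)

text \<open>Dropping the shift of \<open>e\<close> is injective on tied instances by
  \<open>tie_shift_unique\<close>, which saves one factor \<open>L\<close>.\<close>

lemma card_tie_le:
  assumes "e \<in> I" "e' \<in> I" "e' \<noteq> e"
  shows "card {(\<xi>, s). \<xi> \<in> signs \<and> s \<in> PiE I (\<lambda>_. {..<L}) \<and> tie \<xi> s r e e'}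
    \<le> 2 ^ card I * L ^ (card I - 1)"
proof -
  let ?T = "{(\<xi>, s). \<xi> \<in> signs \<and> s \<in> PiE I (\<lambda>_. {..<L}) \<and> tie \<xi> s r e e'}"
  let ?h = "\<lambda>(\<xi>, s). (\<xi>, restrict s (I - {e}))"
  have "inj_on ?h ?T"
  proof (rule inj_onI)
    fix p p' assume p: "p \<in> ?T" and p': "p' \<in> ?T" and h: "?h p = ?h p'"
    obtain \<xi> s where ps: "p = (\<xi>, s)" by (cases p)
    obtain s' where ps': "p' = (\<xi>, s')" using h ps by (cases p') auto
    have \<xi>: "\<xi> \<in> signs" and s: "s \<in> PiE I (\<lambda>_. {..<L})" "s' \<in> PiE I (\<lambda>_. {..<L})"
      and t: "tie \<xi> s r e e'" "tie \<xi> s' r e e'" and r: "restrict s (I - {e}) = restrict s' (I - {e})"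
      using p p' h ps ps' by auto
    have off: "s d = s' d" if "d \<in> I" "d \<noteq> e" for d
      using fun_cong[OF r, of d] that by simp
    have "s e = s' e" by (rule tie_shift_unique[OF \<xi> assms off t])
    then have "s = s'" using off by (intro PiE_ext[OF s]) blast
    then show "p = p'" using ps ps' by simp
  qed
  moreover have "?h ` ?T \<subseteq> signs \<times> PiE (I - {e}) (\<lambda>_. {..<L})"
    by (auto simp: PiE_iff extensional_def split: if_splits)
  moreover have "finite (signs \<times> PiE (I - {e}) (\<lambda>_. {..<L}))"
    using finI by (intro finite_cartesian_product finite_signs finite_PiE) auto
  ultimately have "card ?T \<le> card (signs \<times> PiE (I - {e}) (\<lambda>_. {..<L}))" by (rule card_inj_on_le)
  also have "\<dots> = 2 ^ card I * L ^ (card I - 1)"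
    using finI assms by (simp add: card_cartesian_product card_signs card_PiE)
  finally show ?thesis .
qed

text \<open>A solved instance without ties is encoded by its shifts and its \<open>matched\<close>
  set of at most \<open>Q\<close> elements. Instances with ties are counted separately, over all
  queries and ordered pairs of indices.\<close>

lemma card_solved_le:
  assumes L: "\<delta> * real L \<le> \<gamma>"
  shows "card {(\<xi>, s). \<xi> \<in> signs \<and> s \<in> PiE I (\<lambda>_. {..<L}) \<and> solved Q \<gamma> \<xi> s}
    \<le> card {H. H \<subseteq> I \<and> card H \<le> Q} * L ^ card I
      + Suc Q * card I * card I * (2 ^ card I * L ^ (card I - 1))"
proof -
  let ?O = "\<lambda>\<xi> s. \<xi> \<in> signs \<and> s \<in> PiE I (\<lambda>_. {..<L})"
  let ?t = "\<lambda>(r, e, e'). {(\<xi>, s). ?O \<xi> s \<and> e' \<noteq> e \<and> tie \<xi> s r e e'}"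
  let ?T = "\<Union>p\<in>{..Q} \<times> I \<times> I. ?t p"
  let ?N = "{(\<xi>, s). ?O \<xi> s \<and> solved Q \<gamma> \<xi> s} - ?T"
  have fin: "finite {(\<xi>, s). ?O \<xi> s}"
  proof -
    have "finite (signs \<times> PiE I (\<lambda>_. {..<L}))"
      using finI by (intro finite_cartesian_product finite_signs finite_PiE) auto
    then show ?thesis by (rule rev_finite_subset) auto
  qed
  have "card ?T \<le> (\<Sum>p\<in>{..Q} \<times> I \<times> I. card (?t p))"
    using finI by (intro card_UN_le) auto
  also have "\<dots> \<le> (\<Sum>p\<in>{..Q} \<times> I \<times> I. 2 ^ card I * L ^ (card I - 1))"
  proof (intro sum_mono)
    fix p assume p: "p \<in> {..Q} \<times> I \<times> I"
    obtain r e e' where pe: "p = (r, e, e')" by (cases p)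
    show "card (?t p) \<le> 2 ^ card I * L ^ (card I - 1)"
    proof (cases "e' = e")
      case False
      then have "?t p = {(\<xi>, s). \<xi> \<in> signs \<and> s \<in> PiE I (\<lambda>_. {..<L}) \<and> tie \<xi> s r e e'}"
        by (auto simp: pe)
      then show ?thesis using card_tie_le[of e e' L r] p False by (simp add: pe)
    qed (simp add: pe)
  qed
  also have "\<dots> = Suc Q * card I * card I * (2 ^ card I * L ^ (card I - 1))"
    by (simp add: card_cartesian_product algebra_simps)
  finally have T: "card ?T \<le> Suc Q * card I * card I * (2 ^ card I * L ^ (card I - 1))" .
  let ?h = "\<lambda>(\<xi>, s). (matched Q \<xi> s, s)"
  have "inj_on ?h ?N"
  proof (rule inj_onI)
    fix p p' assume p: "p \<in> ?N" and p': "p' \<in> ?N" and h: "?h p = ?h p'"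
    obtain \<xi> s where ps: "p = (\<xi>, s)" by (cases p)
    obtain \<xi>' where ps': "p' = (\<xi>', s)" using h ps by (cases p') auto
    have \<xi>: "\<xi> \<in> signs" "\<xi>' \<in> signs" and s: "s \<in> PiE I (\<lambda>_. {..<L})" and so: "solved Q \<gamma> \<xi> s"
      and m: "matched Q \<xi> s = matched Q \<xi>' s"
      using p p' h ps ps' by auto
    \<comment> \<open>The two runs agree through query \<open>Q\<close>, and by then every sign has
      been revealed.\<close>
    have "\<forall>e\<in>I. \<xi> e = \<xi>' e"
      using matched_determines_run[OF \<xi> m, of "Suc Q"] solved_processed[OF so s L] by simp
    then have "\<xi> = \<xi>'" using \<xi> unfolding signs_def by (intro PiE_ext[of \<xi> I _ \<xi>']) auto
    then show "p = p'" using ps ps' by simp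
  qed
  moreover have "?h ` ?N \<subseteq> {H. H \<subseteq> I \<and> card H \<le> Q} \<times> PiE I (\<lambda>_. {..<L})"
  proof
    fix y assume "y \<in> ?h ` ?N"
    then obtain \<xi> s where y: "y = (matched Q \<xi> s, s)" and N: "(\<xi>, s) \<in> ?N" by auto
    have c: "\<xi> \<in> signs" "s \<in> PiE I (\<lambda>_. {..<L})" "solved Q \<gamma> \<xi> s" using N by auto
    have "card (matched Q \<xi> s) \<le> Q"
    proof (rule card_matched_le[OF c(1,3,2) L])
      fix r e e' assume "r \<le> Q" "e \<in> I" "e' \<in> I" "e' \<noteq> e"
      then show "\<not> tie \<xi> s r e e'" using N c by auto
    qed
    then show "y \<in> {H. H \<subseteq> I \<and> card H \<le> Q} \<times> PiE I (\<lambda>_. {..<L})"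
      using c y by (auto simp: matched_def)
  qed
  moreover have "finite ({H. H \<subseteq> I \<and> card H \<le> Q} \<times> PiE I (\<lambda>_. {..<L}))"
    using finI by (intro finite_cartesian_product finite_PiE) auto
  ultimately have "card ?N \<le> card ({H. H \<subseteq> I \<and> card H \<le> Q} \<times> PiE I (\<lambda>_. {..<L}))"
    by (rule card_inj_on_le)
  also have "\<dots> = card {H. H \<subseteq> I \<and> card H \<le> Q} * L ^ card I"
    using finI by (simp add: card_cartesian_product card_PiE)
  finally have N: "card ?N \<le> card {H. H \<subseteq> I \<and> card H \<le> Q} * L ^ card I" .
  have "card {(\<xi>, s). ?O \<xi> s \<and> solved Q \<gamma> \<xi> s} \<le> card (?N \<union> ?T)"
    by (rule card_mono) (auto intro!: finite_subset[OF _ fin])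
  also have "\<dots> \<le> card ?N + card ?T" by (rule card_Un_le)
  finally have "card {(\<xi>, s). ?O \<xi> s \<and> solved Q \<gamma> \<xi> s} \<le> card ?N + card ?T" .
  with N T show ?thesis by (simp only: conj_assoc)
qed

end

section \<open>From counting to expected oracle calls\<close>

context hard_run
begin

lemma reached_run:
  assumes "reached orc A (hardf \<xi> s) p"
  shows "p = run \<xi> s (length p)"
  using assms
proof induction
  case (query p X)
  then have "point (A (run \<xi> s (length p))) = X" by (metis decision.sel(2))
  with query.IH show ?case by simp
qed simp

text \<open>The matrix \<open>W\<close> shows that the infimum is at most \<open>- \<beta>\<close>,
  since shifts only lower the values. An output within \<open>\<epsilon>\<close> of it thus solves
  the instance at level \<open>\<beta> - \<epsilon>\<close>, and it is the query of index
  \<open>length p\<close> in the continued run.\<close>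

lemma oracle_calls_unsolved:
  assumes \<xi>: "\<xi> \<in> signs" and W: "W \<in> op_ball m n R"
    and le: "\<And>e. e \<in> I \<Longrightarrow> G * (\<xi> e * W $$ pos e) \<le> - \<beta>"
    and un: "\<not> solved Q (\<beta> - \<epsilon>) \<xi> s"
  shows "of_nat (Suc Q) \<le> oracle_calls (op_ball m n R) orc A (hardf \<xi> s) \<epsilon>"
  unfolding oracle_calls_def
proof (rule Inf_greatest, clarify)
  fix p X
  assume p: "reached orc A (hardf \<xi> s) p" "A p = Stop X"
    and X: "hardf \<xi> s X - (INF Y\<in>op_ball m n R. hardf \<xi> s Y) \<le> \<epsilon>"
  have Wc: "W \<in> carrier_mat m n" using W by (simp add: op_ball_def)
  obtain e0 where e0: "e0 \<in> I" using neI by blast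
  have bdd: "bdd_below (hardf \<xi> s ` op_ball m n R)"
  proof (rule bdd_belowI2)
    fix Y assume Y: "Y \<in> op_ball m n R"
    then have Yc: "Y \<in> carrier_mat m n" "op_norm Y \<le> R" by (auto simp: op_ball_def)
    have "\<bar>\<xi> e0 * Y $$ pos e0\<bar> \<le> R"
      using abs_entry_le_op_norm[OF Yc(1), of "fst (pos e0)" "snd (pos e0)"] Yc(2) pos[OF e0]
      by (cases "pos e0") (auto simp: abs_mult signs_abs[OF \<xi> e0])
    then have "- (G * R) \<le> G * (\<xi> e0 * Y $$ pos e0)"
      using G mult_left_mono[of "- R" "\<xi> e0 * Y $$ pos e0" G] by (simp add: abs_le_iff)
    then show "- (G * R) - \<delta> * real (s e0) \<le> hardf \<xi> s Y"
      using piece_le_hardf[OF Yc(1) e0, of \<xi> s] by (simp add: piece_def)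
  qed
  obtain e where e: "e \<in> I" "hardf \<xi> s W = piece \<xi> s e W" using hardf_attained[OF Wc] .
  have "0 \<le> \<delta> * real (s e)" using \<delta> by simp
  then have "hardf \<xi> s W \<le> - \<beta>" using le[OF e(1)] e(2) by (simp add: piece_def)
  moreover have "(INF Y\<in>op_ball m n R. hardf \<xi> s Y) \<le> hardf \<xi> s W"
    by (rule cINF_lower[OF bdd W])
  moreover have "X = qry \<xi> s (length p)"
    using reached_run[OF p(1)] p(2) by (metis decision.sel(1) qry_def)
  ultimately have "hardf \<xi> s (qry \<xi> s (length p)) \<le> - (\<beta> - \<epsilon>)" using X by simp
  then have "Suc Q \<le> length p" using un by (auto simp: solved_def not_less_eq_eq[symmetric])
  then show "of_nat (Suc Q) \<le> (of_nat (length p) :: ennreal)" by (simp only: of_nat_le_iff)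
qed

end

text \<open>The distribution is uniform over patterns in \<open>Gd\<close> and shifts. At most 3/4
  of these instances are solved by query \<open>Q\<close>: at most 1/2 without ties, from the bound
  on small subsets by \<open>card Gd\<close>, and at most 1/4 with ties. The others cost at least
  \<open>Q + 1\<close> calls.\<close>

lemma dc_lower_bound:
  fixes I :: "'i set" and pos :: "'i \<Rightarrow> nat \<times> nat"
  assumes local: "local_oracle m n (op_class m n G R) orc"
    and finI: "finite I" and neI: "I \<noteq> {}" and pos: "\<And>e. e \<in> I \<Longrightarrow> pos e \<in> {..<m} \<times> {..<n}"
    and G: "0 < G" and \<beta>: "\<epsilon> < \<beta>"
    and Gd: "Gd \<subseteq> PiE I (\<lambda>_. {-1, 1})"
    and min: "\<And>\<xi>. \<xi> \<in> Gd \<Longrightarrow> \<exists>W\<in>op_ball m n R. \<forall>e\<in>I. G * (\<xi> e * W $$ pos e) \<le> - \<beta>"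
    and card: "2 * card {H. H \<subseteq> I \<and> card H \<le> Q} \<le> card Gd"
  shows "ennreal (real (Suc Q) / 4) \<le> dc m n (op_ball m n R) (op_class m n G R) orc \<epsilon>"
proof -
  define M where "M = card I"
  define B where "B = card {H. H \<subseteq> I \<and> card H \<le> Q}"
  \<comment> \<open>Makes four times the bound for ties equal to \<open>L ^ M\<close>. With the
    \<open>\<delta>\<close> chosen next, every shift \<open>\<delta> * s e\<close> stays below the
    margin \<open>\<beta> - \<epsilon>\<close>.\<close>
  define L where "L = 4 * Suc Q * M * M * 2 ^ M"
  define \<delta> where "\<delta> = (\<beta> - \<epsilon>) / real L"
  have M: "M > 0" using finI neI by (simp add: M_def card_gt_0_iff)
  then have L: "L > 0" by (simp add: L_def)
  have \<delta>0: "\<delta> > 0" and \<delta>L: "\<delta> * real L \<le> \<beta> - \<epsilon>" using \<beta> L by (auto simp: \<delta>_def)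
  interpret hard_family m n G \<delta> I pos
    by unfold_locales (use finI neI pos G \<delta>0 in auto)
  have GS: "Gd \<subseteq> signs" using Gd by (simp add: signs_def)
  have "finite {H. H \<subseteq> I \<and> card H \<le> Q}" using finI by simp
  moreover have "{} \<in> {H. H \<subseteq> I \<and> card H \<le> Q}" by simp
  ultimately have "B > 0" unfolding B_def using card_gt_0_iff by blast
  then have Gd1: "card Gd > 0" using card by (simp add: B_def)
  then have finG: "finite Gd" using card_gt_0_iff by blast
  define \<Omega> where "\<Omega> = Gd \<times> PiE I (\<lambda>_. {..<L})"
  have fin\<Omega>: "finite \<Omega>" unfolding \<Omega>_def using finG finI by (intro finite_cartesian_product finite_PiE) auto
  have c\<Omega>: "card \<Omega> = card Gd * L ^ M"
    using finI by (simp add: \<Omega>_def card_cartesian_product card_PiE M_def)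
  then have \<Omega>0: "card \<Omega> > 0" using Gd1 L by simp
  let ?F = "op_class m n G R"
  let ?h = "\<lambda>(\<xi>, s). hardf \<xi> s"
  \<comment> \<open>On the discrete sigma-algebra every integrand is measurable, whatever the
    oracle.\<close>
  define P where "P = distr (uniform_count_measure \<Omega>) (count_space ?F) ?h"
  have hF: "?h \<in> uniform_count_measure \<Omega> \<rightarrow>\<^sub>M count_space ?F"
    using GS by (auto simp: measurable_def space_uniform_count_measure sets_uniform_count_measure
        \<Omega>_def hardf_in_op_class subset_iff)
  have "prob_space P"
    unfolding P_def using fin\<Omega> \<Omega>0
    by (intro prob_space.prob_space_distr hF prob_space_uniform_count_measure) auto
  then have P: "P \<in> distributions_on ?F" by (simp add: distributions_on_def P_def)
  have "ennreal (real (Suc Q) / 4) \<le> (\<integral>\<^sup>+ f. oracle_calls (op_ball m n R) orc A f \<epsilon> \<partial>P)"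
    if A: "A \<in> algorithms m n" for A
  proof -
    interpret hard_run m n G \<delta> I pos R orc A
      by unfold_locales (use local A in auto)
    define So where "So = {(\<xi>, s). \<xi> \<in> signs \<and> s \<in> PiE I (\<lambda>_. {..<L}) \<and> solved Q (\<beta> - \<epsilon>) \<xi> s}"
    define U where "U = \<Omega> - So"
    have finS: "finite So"
    proof -
      have "finite (signs \<times> PiE I (\<lambda>_. {..<L}))"
        using finI by (intro finite_cartesian_product finite_signs finite_PiE) auto
      then show ?thesis by (rule rev_finite_subset) (auto simp: So_def)
    qed
    have "card So \<le> B * L ^ M + Suc Q * M * M * (2 ^ M * L ^ (M - 1))"
      using card_solved_le[OF \<delta>L, of Q] by (simp add: So_def B_def M_def)
    then have "4 * card So \<le> 2 * (2 * B) * L ^ M + L * L ^ (M - 1)"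
      by (simp add: L_def algebra_simps)
    also have "L * L ^ (M - 1) = 1 * L ^ M" using M by (simp add: power_eq_if)
    also have "2 * (2 * B) * L ^ M + 1 * L ^ M \<le> 2 * card Gd * L ^ M + card Gd * L ^ M"
      using card Gd1 by (intro add_mono mult_right_mono) (auto simp: B_def)
    finally have "4 * card So \<le> 3 * card \<Omega>" by (simp add: c\<Omega>)
    moreover have "card \<Omega> \<le> card U + card So"
    proof -
      have "card \<Omega> \<le> card (U \<union> So)"
        using fin\<Omega> finS by (intro card_mono) (auto simp: U_def)
      then show ?thesis using card_Un_le[of U So] by linarith
    qed
    ultimately have cU: "card \<Omega> \<le> 4 * card U" by linarith
    have "real (Suc Q) / 4 = real (Suc Q) * (real (card \<Omega>) / (4 * real (card \<Omega>)))"
      using \<Omega>0 by simp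
    also have "\<dots> \<le> real (Suc Q) * (4 * real (card U) / (4 * real (card \<Omega>)))"
    proof -
      have "real (card \<Omega>) \<le> 4 * real (card U)" using of_nat_mono[OF cU, where 'a = real] by simp
      then show ?thesis by (intro mult_left_mono divide_right_mono) simp_all
    qed
    also have "\<dots> = real (Suc Q) * (real (card U) / real (card \<Omega>))" by simp
    finally have "ennreal (real (Suc Q) / 4) \<le> ennreal (real (Suc Q) * (real (card U) / real (card \<Omega>)))"
      by (rule ennreal_leI)
    also have "\<dots> = of_nat (Suc Q) * emeasure (uniform_count_measure \<Omega>) U"
    proof -
      have "emeasure (uniform_count_measure \<Omega>) U = ennreal (real (card U) / real (card \<Omega>))"
        using fin\<Omega> by (simp add: U_def emeasure_uniform_count_measure)
      then show ?thesis
        unfolding ennreal_of_nat_eq_real_of_nat by (simp only:) (rule ennreal_mult, simp_all)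
    qed
    also have "\<dots> = (\<integral>\<^sup>+ \<omega>. of_nat (Suc Q) * indicator U \<omega> \<partial>uniform_count_measure \<Omega>)"
      by (rule nn_integral_cmult_indicator[symmetric]) (simp add: U_def sets_uniform_count_measure)
    also have "\<dots> \<le> (\<integral>\<^sup>+ \<omega>. oracle_calls (op_ball m n R) orc A (?h \<omega>) \<epsilon> \<partial>uniform_count_measure \<Omega>)"
    proof (rule nn_integral_mono)
      fix \<omega> assume "\<omega> \<in> space (uniform_count_measure \<Omega>)"
      then have \<omega>: "\<omega> \<in> \<Omega>" by (simp add: space_uniform_count_measure)
      obtain \<xi> s where eq: "\<omega> = (\<xi>, s)" by (cases \<omega>)
      have \<xi>: "\<xi> \<in> Gd" "\<xi> \<in> signs" "s \<in> PiE I (\<lambda>_. {..<L})" using \<omega> GS by (auto simp: eq \<Omega>_def)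
      obtain W where W: "W \<in> op_ball m n R" "\<And>e. e \<in> I \<Longrightarrow> G * (\<xi> e * W $$ pos e) \<le> - \<beta>"
        using min[OF \<xi>(1)] by blast
      show "of_nat (Suc Q) * indicator U \<omega> \<le> oracle_calls (op_ball m n R) orc A (?h \<omega>) \<epsilon>"
      proof (cases "\<omega> \<in> U")
        case True
        then have "\<not> solved Q (\<beta> - \<epsilon>) \<xi> s" using \<xi> by (auto simp: U_def So_def eq)
        from oracle_calls_unsolved[OF \<xi>(2) W this] True show ?thesis by (simp add: eq del: of_nat_Suc)
      qed simp
    qed
    also have "\<dots> = (\<integral>\<^sup>+ f. oracle_calls (op_ball m n R) orc A f \<epsilon> \<partial>P)"
      unfolding P_def by (rule nn_integral_distr[symmetric, OF hF]) simp
    finally show ?thesis .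
  qed
  then have "ennreal (real (Suc Q) / 4)
      \<le> (INF A\<in>algorithms m n. \<integral>\<^sup>+ f. oracle_calls (op_ball m n R) orc A f \<epsilon> \<partial>P)"
    by (intro INF_greatest)
  then show ?thesis unfolding dc_def using P by (intro SUP_upper2[of P])
qed

section \<open>Block diagonal sign patterns\<close>

lemma sum_lessThan_blocks:
  "(\<Sum>i<q * a. f i) = (\<Sum>t<q. \<Sum>i<a. f (t * a + i))" for q a :: nat
proof (induction q)
  case (Suc q)
  have "(\<Sum>i<N + k. f i) = (\<Sum>i<N. f i) + (\<Sum>i<k. f (N + i))" for N k
    by (induction k) (simp_all add: add.assoc)
  from this[of "q * a" a] Suc show ?case by (simp add: add.commute)
qed simp

lemma L2_set_blocks:
  fixes q a m :: nat
  assumes "q * a \<le> m"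
  shows "(\<Sum>t<q. (L2_set (\<lambda>i. x (t * a + i)) {..<a})\<^sup>2) \<le> (L2_set x {..<m})\<^sup>2"
proof -
  have "(\<Sum>t<q. (L2_set (\<lambda>i. x (t * a + i)) {..<a})\<^sup>2) = (\<Sum>i<q * a. (x i)\<^sup>2)"
    by (simp add: L2_set_power2 sum_lessThan_blocks)
  also have "\<dots> \<le> (\<Sum>i<m. (x i)\<^sup>2)" using assms by (intro sum_mono2) auto
  finally show ?thesis by (simp add: L2_set_power2)
qed

definition block_diag :: "nat \<Rightarrow> nat \<Rightarrow> nat \<Rightarrow> (nat \<Rightarrow> nat \<times> nat \<Rightarrow> real) \<Rightarrow> nat \<times> nat \<Rightarrow> real" where
  "block_diag q a b g = (\<lambda>(i, j). if i < q * a \<and> j < q * b \<and> i div a = j div b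
     then g (i div a) (i mod a, j mod b) else 0)"

lemma block_diag_entry:
  assumes "t < q" "i < a" "t' < q" "j < b"
  shows "block_diag q a b g (t * a + i, t' * b + j) = (if t = t' then g t (i, j) else 0)"
proof -
  have "t * a + i < q * a" if "t < q" "i < a" for t i a :: nat
  proof -
    have "t * a + i < Suc t * a" using that by simp
    also have "\<dots> \<le> q * a" using that by (intro mult_right_mono) auto
    finally show ?thesis .
  qed
  then show ?thesis using assms by (simp add: block_diag_def)
qed

lemma sum_block_diag:
  assumes q: "q * a \<le> m" "q * b \<le> n"
  shows "(\<Sum>i<m. \<Sum>j<n. block_diag q a b g (i, j) * x i * y j)
    = (\<Sum>t<q. \<Sum>i<a. \<Sum>j<b. g t (i, j) * x (t * a + i) * y (t * b + j))"
proof -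
  let ?f = "\<lambda>i j. block_diag q a b g (i, j) * x i * y j"
  have inner: "(\<Sum>j<n. ?f i j) = (\<Sum>t<q. \<Sum>j<b. ?f i (t * b + j))" for i
    unfolding sum_lessThan_blocks[where f = "?f i", symmetric]
    using q by (intro sum.mono_neutral_right) (auto simp: block_diag_def)
  have "(\<Sum>i<m. \<Sum>j<n. ?f i j) = (\<Sum>i<q * a. \<Sum>j<n. ?f i j)"
    using q by (intro sum.mono_neutral_right) (auto simp: block_diag_def)
  also have "\<dots> = (\<Sum>t<q. \<Sum>i<a. \<Sum>t'<q. \<Sum>j<b. ?f (t * a + i) (t' * b + j))"
    unfolding sum_lessThan_blocks inner ..
  also have "\<dots> = (\<Sum>t<q. \<Sum>i<a. \<Sum>t'<q. if t = t' then \<Sum>j<b. g t (i, j) * x (t * a + i) * y (t * b + j) else 0)"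
    by (intro sum.cong refl) (auto simp: block_diag_entry)
  also have "\<dots> = (\<Sum>t<q. \<Sum>i<a. \<Sum>j<b. g t (i, j) * x (t * a + i) * y (t * b + j))"
    by (rule sum.cong[OF refl], rule sum.cong[OF refl]) simp
  finally show ?thesis .
qed

text \<open>Cauchy-Schwarz over the blocks, so that the norm does not grow with \<open>q\<close>.
  The entries are opposite to the signs, which makes all pieces negative; in the estimate the minus
  sign moves into \<open>x\<close>.\<close>

lemma op_norm_block_diag:
  assumes q: "q * a \<le> m" "q * b \<le> n" and "0 < \<tau>" "0 \<le> R"
    and g: "\<And>t x y. t < q \<Longrightarrow> (\<Sum>i<a. \<Sum>j<b. g t (i, j) * x i * y j) \<le> \<tau> * L2_set x {..<a} * L2_set y {..<b}"
  shows "op_norm (mat m n (\<lambda>e. - (R / \<tau>) * block_diag q a b g e)) \<le> R"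
proof (rule op_norm_leI)
  fix x y :: "nat \<Rightarrow> real"
  let ?x = "\<lambda>t. L2_set (\<lambda>i. x (t * a + i)) {..<a}" and ?y = "\<lambda>t. L2_set (\<lambda>j. y (t * b + j)) {..<b}"
  have "(\<Sum>i<m. \<Sum>j<n. mat m n (\<lambda>e. - (R / \<tau>) * block_diag q a b g e) $$ (i, j) * x i * y j)
      = (R / \<tau>) * (\<Sum>i<m. \<Sum>j<n. block_diag q a b g (i, j) * (- x i) * y j)"
    unfolding sum_distrib_left by (intro sum.cong refl) simp
  also have "\<dots> = (R / \<tau>) * (\<Sum>t<q. \<Sum>i<a. \<Sum>j<b. g t (i, j) * (- x (t * a + i)) * y (t * b + j))"
    using sum_block_diag[OF q, of g "\<lambda>i. - x i" y] by simp
  also have "\<dots> \<le> (R / \<tau>) * (\<Sum>t<q. \<tau> * (?x t * ?y t))"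
  proof (intro mult_left_mono sum_mono)
    fix t assume "t \<in> {..<q}"
    then show "(\<Sum>i<a. \<Sum>j<b. g t (i, j) * (- x (t * a + i)) * y (t * b + j)) \<le> \<tau> * (?x t * ?y t)"
      using g[of t "\<lambda>i. - x (t * a + i)" "\<lambda>j. y (t * b + j)"] by (simp add: L2_set_def mult_ac)
  qed (use assms in simp)
  also have "\<dots> = R * (\<Sum>t<q. ?x t * ?y t)"
    using \<open>0 < \<tau>\<close> by (simp add: sum_distrib_left[symmetric])
  also have "\<dots> \<le> R * (L2_set x {..<m} * L2_set y {..<n})"
  proof (intro mult_left_mono \<open>0 \<le> R\<close>)
    have "L2_set ?x {..<q} \<le> L2_set x {..<m}"
      by (rule power2_le_imp_le; (subst L2_set_power2[of ?x])?) (rule L2_set_blocks[OF q(1)], simp)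
    moreover have "L2_set ?y {..<q} \<le> L2_set y {..<n}"
      by (rule power2_le_imp_le; (subst L2_set_power2[of ?y])?) (rule L2_set_blocks[OF q(2)], simp)
    ultimately have "L2_set ?x {..<q} * L2_set ?y {..<q} \<le> L2_set x {..<m} * L2_set y {..<n}"
      by (intro mult_mono) simp_all
    with L2_set_mult_le[of ?x ?y "{..<q}"]
    show "(\<Sum>t<q. ?x t * ?y t) \<le> L2_set x {..<m} * L2_set y {..<n}" by linarith
  qed
  finally show "(\<Sum>i<m. \<Sum>j<n. mat m n (\<lambda>e. - (R / \<tau>) * block_diag q a b g e) $$ (i, j) * x i * y j)
      \<le> R * L2_set x {..<m} * L2_set y {..<n}"
    by (simp only: mult.assoc)
qed (use assms in simp_all)

section \<open>Counting small subsets and choosing the blocks\<close>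

text \<open>Weighting a subset of size \<open>k\<close> by \<open>8 ^ (Q - k) \<ge> 1\<close> and
  completing the binomial sum gives \<open>8 ^ Q * (9 / 8) ^ M\<close>. In the fourth power,
  \<open>8 ^ (4 * Q) = 2 ^ (12 * Q) \<le> 2 ^ M\<close> and \<open>(9 / 8) ^ 4 < 2\<close>.\<close>

lemma card_subsets_le_square:
  assumes I: "finite I" and Q: "12 * Q \<le> card I"
  shows "(card {H. H \<subseteq> I \<and> card H \<le> Q})\<^sup>2 \<le> 2 ^ card I"
proof -
  define M where "M = card I"
  define B where "B = card {H. H \<subseteq> I \<and> card H \<le> Q}"
  have "{H. H \<subseteq> I \<and> card H \<le> Q} = (\<Union>k\<le>Q. {H. H \<subseteq> I \<and> card H = k})" by auto
  then have "B \<le> (\<Sum>k\<le>Q. card {H. H \<subseteq> I \<and> card H = k})"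
    unfolding B_def by (simp add: card_UN_le)
  also have "\<dots> = (\<Sum>k\<le>Q. M choose k)" using I by (simp add: n_subsets M_def)
  finally have "real B \<le> real (\<Sum>k\<le>Q. M choose k)" by (rule of_nat_mono)
  also have "\<dots> = (\<Sum>k\<le>Q. real (M choose k))" by (rule of_nat_sum)
  also have "\<dots> \<le> (\<Sum>k\<le>Q. 8 ^ Q * (real (M choose k) * (1 / 8) ^ k))"
  proof (intro sum_mono)
    fix k assume "k \<in> {..Q}"
    then have "(8::real) ^ k \<le> 8 ^ Q" by (intro power_increasing) auto
    then have "(1::real) \<le> 8 ^ Q * (1 / 8) ^ k" by (simp add: power_one_over)
    then have "real (M choose k) * 1 \<le> real (M choose k) * (8 ^ Q * (1 / 8) ^ k)"
      by (intro mult_left_mono) auto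
    then show "real (M choose k) \<le> 8 ^ Q * (real (M choose k) * (1 / 8) ^ k)" by (simp add: mult_ac)
  qed
  also have "\<dots> \<le> (\<Sum>k\<le>M. 8 ^ Q * (real (M choose k) * (1 / 8) ^ k))"
    using Q by (intro sum_mono2) (auto simp: M_def)
  also have "\<dots> = 8 ^ Q * (9 / 8) ^ M"
    using binomial_ring[of "1 / 8 :: real" 1 M] by (simp add: sum_distrib_left[symmetric])
  finally have "real B ^ 4 \<le> (8 ^ Q * (9 / 8) ^ M) ^ 4" by (rule power_mono) simp
  also have "\<dots> = 2 ^ (12 * Q) * ((9 / 8) ^ 4) ^ M"
  proof -
    have "(8::real) ^ Q = 2 ^ (3 * Q)" unfolding power_mult by simp
    then have "((8::real) ^ Q) ^ 4 = 2 ^ (12 * Q)" by (simp flip: power_mult)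
    moreover have "((9 / 8 :: real) ^ M) ^ 4 = ((9 / 8) ^ 4) ^ M"
      by (simp only: power_mult[symmetric] mult.commute)
    ultimately show ?thesis by (simp only: power_mult_distrib)
  qed
  also have "\<dots> \<le> 2 ^ M * 2 ^ M"
    using Q by (intro mult_mono power_increasing power_mono) (auto simp: M_def power_divide)
  also have "real B ^ 4 = (real (B\<^sup>2))\<^sup>2" by (simp flip: power_mult)
  also have "(2::real) ^ M * 2 ^ M = (2 ^ M)\<^sup>2" by (simp only: power2_eq_square)
  finally have "(real (B\<^sup>2))\<^sup>2 \<le> (2 ^ M)\<^sup>2" .
  then have "real (B\<^sup>2) \<le> 2 ^ M" by (rule power2_le_imp_le) simp
  then have "real (B\<^sup>2) \<le> real (2 ^ M)" by simp
  then show ?thesis unfolding of_nat_le_iff B_def M_def .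
qed

lemma dc_block_lower_bound:
  assumes local: "local_oracle m n (op_class m n G R) orc"
    and pos: "0 < G" "0 < R" "0 < \<epsilon>" and size: "0 < q" "0 < a" "0 < b" "q * a \<le> m" "q * b \<le> n"
    and \<tau>: "0 < \<tau>" "\<tau> < G * R / \<epsilon>"
    and Gd: "Gd \<subseteq> PiE ({..<a} \<times> {..<b}) (\<lambda>_. {-1, 1})"
    and norm: "\<And>\<xi> x y. \<xi> \<in> Gd \<Longrightarrow>
      (\<Sum>i<a. \<Sum>j<b. \<xi> (i, j) * x i * y j) \<le> \<tau> * L2_set x {..<a} * L2_set y {..<b}"
    and card: "4 * 2 ^ (q * a * b) \<le> (card Gd ^ q)\<^sup>2 \<or> q * a * b = 1 \<and> card Gd = 2"
  shows "ennreal (real (q * a * b) / 48) \<le> dc m n (op_ball m n R) (op_class m n G R) orc \<epsilon>"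
proof -
  define I where "I = {..<q} \<times> ({..<a} \<times> {..<b})"
  define loc where "loc = (\<lambda>(t, i, j). (t * a + i, t * b + j))"
  define \<Phi> where "\<Phi> g = restrict (\<lambda>(t, e). g t e) I" for g :: "nat \<Rightarrow> nat \<times> nat \<Rightarrow> real"
  \<comment> \<open>The 12 is what \<open>card_subsets_le_square\<close> asks for; with the factor
    1/4 of \<open>dc_lower_bound\<close> it becomes the 48 of the conclusion.\<close>
  define Q where "Q = q * a * b div 12"
  have finI: "finite I" and neI: "I \<noteq> {}" and cI: "card I = q * a * b"
    using size by (auto simp: I_def card_cartesian_product)
  have finG: "finite Gd" by (rule finite_subset[OF Gd]) (auto intro!: finite_PiE)
  have inj: "inj_on \<Phi> (PiE {..<q} (\<lambda>_. Gd))"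
  proof (rule inj_onI)
    fix g h assume g: "g \<in> PiE {..<q} (\<lambda>_. Gd)" and h: "h \<in> PiE {..<q} (\<lambda>_. Gd)" and eq: "\<Phi> g = \<Phi> h"
    show "g = h"
    proof (rule PiE_ext[OF g h])
      fix t assume t: "t \<in> {..<q}"
      show "g t = h t"
      proof (rule PiE_ext)
        show "g t \<in> PiE ({..<a} \<times> {..<b}) (\<lambda>_. {-1, 1})" "h t \<in> PiE ({..<a} \<times> {..<b}) (\<lambda>_. {-1, 1})"
          using PiE_mem[OF g t] PiE_mem[OF h t] Gd by auto
        fix e assume "e \<in> {..<a} \<times> {..<b}"
        then show "g t e = h t e"
          using fun_cong[OF eq, of "(t, e)"] t by (simp add: \<Phi>_def I_def)
      qed
    qed
  qed
  let ?Gd = "\<Phi> ` PiE {..<q} (\<lambda>_. Gd)"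
  have cG: "card ?Gd = card Gd ^ q" using card_image[OF inj] by (simp add: card_PiE)
  have "ennreal (real (Suc Q) / 4) \<le> dc m n (op_ball m n R) (op_class m n G R) orc \<epsilon>"
  proof (rule dc_lower_bound[OF local finI neI, where pos = loc and Gd = ?Gd and \<beta> = "G * R / \<tau>"])
    show "loc e \<in> {..<m} \<times> {..<n}" if "e \<in> I" for e
    proof -
      have lt: "t * a + i < k" if "t < q" "i < a" "q * a \<le> k" for t i a k
      proof -
        have "t * a + i < Suc t * a" using that by simp
        also have "\<dots> \<le> q * a" using that by (intro mult_right_mono) auto
        finally show ?thesis using that by simp
      qed
      show ?thesis using that size by (auto simp: I_def loc_def intro!: lt)
    qed
    show "\<epsilon> < G * R / \<tau>" using \<tau> pos by (simp add: field_simps)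
    show "?Gd \<subseteq> PiE I (\<lambda>_. {-1, 1})"
    proof (clarsimp simp: \<Phi>_def I_def)
      fix g t i j assume g: "g \<in> PiE {..<q} (\<lambda>_. Gd)" and "t < q" "i < a" "j < b" "g t (i, j) \<noteq> - 1"
      then show "g t (i, j) = 1" using Gd PiE_mem[OF g, of t] by (auto simp: PiE_iff subset_iff)
    qed
    show "2 * card {H. H \<subseteq> I \<and> card H \<le> Q} \<le> card ?Gd"
    proof -
      define B where "B = card {H. H \<subseteq> I \<and> card H \<le> Q}"
      have B: "B\<^sup>2 \<le> 2 ^ (q * a * b)"
        using card_subsets_le_square[OF finI, of Q] by (simp add: cI Q_def B_def)
      show ?thesis
        unfolding cG B_def[symmetric]
      proof (rule disjE[OF card])
        assume "4 * 2 ^ (q * a * b) \<le> (card Gd ^ q)\<^sup>2"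
        then have "(2 * B)\<^sup>2 \<le> (card Gd ^ q)\<^sup>2" using B by (simp add: power_mult_distrib)
        then show "2 * B \<le> card Gd ^ q" by (rule power2_le_imp_le) simp
      next
        assume one: "q * a * b = 1 \<and> card Gd = 2"
        then have "B < 2" using B power_mono[of 2 B 2] by (intro ccontr[of "B < 2"]) (auto simp: not_less)
        then show "2 * B \<le> card Gd ^ q" using one by simp
      qed
    qed
    fix \<xi> assume "\<xi> \<in> ?Gd"
    then obtain g where g: "g \<in> PiE {..<q} (\<lambda>_. Gd)" "\<xi> = \<Phi> g" by blast
    let ?W = "mat m n (\<lambda>e. - (R / \<tau>) * block_diag q a b g e)"
    have "op_norm ?W \<le> R"
      using size \<tau> pos g by (intro op_norm_block_diag norm) auto
    then have "?W \<in> op_ball m n R" by (simp add: op_ball_def)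
    moreover have "G * (\<xi> e * ?W $$ loc e) \<le> - (G * R / \<tau>)" if e: "e \<in> I" for e
    proof -
      obtain t i j where tij: "e = (t, i, j)" "t < q" "i < a" "j < b" using e by (auto simp: I_def)
      have lt: "t * a + i < m" "t * b + j < n"
        using \<open>\<And>e. e \<in> I \<Longrightarrow> loc e \<in> {..<m} \<times> {..<n}\<close>[OF e] by (auto simp: tij loc_def)
      have "g t \<in> Gd" using g tij by auto
      then have "g t \<in> PiE ({..<a} \<times> {..<b}) (\<lambda>_. {-1, 1})" using Gd by blast
      then have "g t (i, j) = -1 \<or> g t (i, j) = 1" using PiE_mem[of "g t" "{..<a} \<times> {..<b}" _ "(i, j)"] tij by auto
      then have sq: "g t (i, j) * g t (i, j) = 1" by auto
      have "\<xi> e * ?W $$ loc e = - (R / \<tau>) * (g t (i, j) * g t (i, j))"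
        using g tij lt e by (simp add: loc_def block_diag_entry \<Phi>_def)
      then show ?thesis by (simp add: sq)
    qed
    ultimately show "\<exists>W\<in>op_ball m n R. \<forall>e\<in>I. G * (\<xi> e * W $$ loc e) \<le> - (G * R / \<tau>)" by blast
  qed (use pos in auto)
  moreover have "real (q * a * b) / 48 \<le> real (Suc Q) / 4"
  proof -
    have "k \<le> 12 * Suc (k div 12)" for k :: nat by presburger
    then have le: "q * a * b \<le> 12 * Suc Q" unfolding Q_def .
    have "real k / 48 \<le> real (Suc j) / 4" if "k \<le> 12 * Suc j" for k j :: nat
      using that by linarith
    from this[OF le] show ?thesis .
  qed
  ultimately show ?thesis by (meson ennreal_leI order_trans)
qed

text \<open>At least half of the patterns of each block are good, so at most \<open>q\<close>
  factors of 2 are lost. With four or more entries per block,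
  \<open>2 * q * (a * b - 1) \<ge> q * a * b + 2\<close>, which is the count required.\<close>

lemma dc_random_block_lower_bound:
  assumes local: "local_oracle m n (op_class m n G R) orc"
    and pos: "0 < G" "0 < R" "0 < \<epsilon>" and size: "0 < q" "q * a \<le> m" "q * b \<le> n" "4 \<le> a * b"
    and K: "152 * real (a + b) < (G * R / \<epsilon>)\<^sup>2"
  shows "ennreal (real (q * a * b) / 48) \<le> dc m n (op_ball m n R) (op_class m n G R) orc \<epsilon>"
proof -
  have ab: "0 < a" "0 < b" using size(4) by (auto intro!: Nat.gr0I)
  obtain Gd where Gd: "Gd \<subseteq> PiE ({..<a} \<times> {..<b}) (\<lambda>_. {-1, 1})" "2 ^ (a * b) \<le> 2 * card Gd"
    "\<And>\<xi> x y. \<xi> \<in> Gd \<Longrightarrow> (\<Sum>i<a. \<Sum>j<b. \<xi> (i, j) * x i * y j)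
       \<le> sqrt (152 * real (a + b)) * L2_set x {..<a} * L2_set y {..<b}"
    using sign_matrices_small_op_norm[OF ab] by blast
  have GRe: "0 < G * R / \<epsilon>" using pos by simp
  show ?thesis
  proof (rule dc_block_lower_bound[OF local pos size(1) ab size(2,3) _ _ Gd(1,3)])
    show "0 < sqrt (152 * real (a + b))" using ab by simp
    show "sqrt (152 * real (a + b)) < G * R / \<epsilon>"
      using K GRe by (intro real_less_lsqrt) auto
    have "(2::nat) ^ (a * b) = 2 * 2 ^ (a * b - 1)"
      using ab by (simp flip: power_Suc)
    then have "(2::nat) ^ (a * b - 1) \<le> card Gd" using Gd(2) by simp
    then have "(2 ^ (a * b - 1)) ^ q \<le> card Gd ^ q" by (rule power_mono) simp
    then have 1: "((2 ^ (a * b - 1)) ^ q)\<^sup>2 \<le> (card Gd ^ q)\<^sup>2" by (rule power_mono) simp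
    have "q * a * b + 2 \<le> 2 * (q * (a * b - 1))"
    proof -
      have "q * 4 \<le> q * (a * b)" using size by (intro mult_left_mono) auto
      moreover have "q * (a * b - 1) = q * (a * b) - q" by (simp add: diff_mult_distrib2)
      moreover have "1 \<le> q" using size by simp
      ultimately show ?thesis unfolding mult.assoc[of q a b] by linarith
    qed
    then have "(2::nat) ^ (q * a * b + 2) \<le> 2 ^ (2 * (q * (a * b - 1)))" by (intro power_increasing) auto
    also have "(2::nat) ^ (2 * (q * (a * b - 1))) = ((2 ^ (a * b - 1)) ^ q)\<^sup>2"
      by (simp add: power_mult[symmetric] mult_ac)
    also note 1
    also have "(2::nat) ^ (q * a * b + 2) = 4 * 2 ^ (q * a * b)" by (simp add: power_add)
    finally show "4 * 2 ^ (q * a * b) \<le> (card Gd ^ q)\<^sup>2 \<or> q * a * b = 1 \<and> card Gd = 2" by (rule disjI1)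
  qed auto
qed

text \<open>Blocks of one entry have norm 1 for either sign, so no pattern is lost. This covers
  bounded \<open>G * R / \<epsilon>\<close>, where random blocks have too large a norm.\<close>

lemma dc_diagonal_lower_bound:
  assumes local: "local_oracle m n (op_class m n G R) orc"
    and pos: "0 < G" "0 < R" "0 < \<epsilon>" and size: "1 \<le> m" "1 \<le> n" and K: "1 < (G * R / \<epsilon>)\<^sup>2"
  shows "ennreal (real (min m n) / 48) \<le> dc m n (op_ball m n R) (op_class m n G R) orc \<epsilon>"
proof -
  let ?X = "PiE ({..<1} \<times> {..<1}) (\<lambda>_. {-1, 1 :: real}) :: (nat \<times> nat \<Rightarrow> real) set"
  have cX: "card ?X = 2" by (simp add: card_PiE card_cartesian_product)
  have "ennreal (real (min m n * 1 * 1) / 48) \<le> dc m n (op_ball m n R) (op_class m n G R) orc \<epsilon>"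
  proof (rule dc_block_lower_bound[OF local pos, where Gd = ?X and \<tau> = 1])
    show "1 < G * R / \<epsilon>" using K pos by (intro power_less_imp_less_base[of 1 2]) auto
    fix \<xi> and x y :: "nat \<Rightarrow> real" assume \<xi>: "\<xi> \<in> ?X"
    have "\<bar>\<xi> (0, 0)\<bar> = 1" using PiE_mem[OF \<xi>, of "(0, 0)"] by auto
    then have "\<bar>\<xi> (0, 0) * x 0 * y 0\<bar> = \<bar>x 0\<bar> * \<bar>y 0\<bar>" by (simp add: abs_mult)
    then show "(\<Sum>i<1. \<Sum>j<1. \<xi> (i, j) * x i * y j) \<le> 1 * L2_set x {..<1} * L2_set y {..<1}"
      by (simp add: L2_set_def)
  next
    show "4 * 2 ^ (min m n * 1 * 1) \<le> (card ?X ^ min m n)\<^sup>2 \<or> min m n * 1 * 1 = 1 \<and> card ?X = 2"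
    proof (cases "min m n = 1")
      case False
      then have "2 + min m n \<le> 2 * min m n" using size by auto
      then have "(2::nat) ^ (2 + min m n) \<le> 2 ^ (2 * min m n)" by (intro power_increasing) auto
      moreover have "(2::nat) ^ (2 + min m n) = 4 * 2 ^ min m n" by (simp add: power_add)
      moreover have "(2::nat) ^ (2 * min m n) = (2 ^ min m n)\<^sup>2" by (simp add: power_mult mult.commute flip: power_mult)
      ultimately show ?thesis by (simp only: cX) simp
    qed (use cX in simp)
  qed (use size in auto)
  then show ?thesis by simp
qed

text \<open>Three regimes: single entries for \<open>K < 4096\<close>, several square blocks of side
  about \<open>K / 1024\<close> as long as these fit, and otherwise one block spanning the shorter
  side. The constant is \<open>196608 = 48 * 4096\<close>.\<close>

lemma dc_op_norm_lower_bound: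
  assumes local: "local_oracle m n (op_class m n G R) orc"
    and pos: "0 < G" "0 < R" "0 < \<epsilon>" and size: "1 \<le> m" "1 \<le> n"
    and K: "1 < (G * R / \<epsilon>)\<^sup>2" "(G * R / \<epsilon>)\<^sup>2 < real (max m n)"
  shows "ennreal (1 / 196608 * real (min m n) * (G * R / \<epsilon>)\<^sup>2)
    \<le> dc m n (op_ball m n R) (op_class m n G R) orc \<epsilon>"
proof -
  define K where "K = (G * R / \<epsilon>)\<^sup>2"
  define d where "d = min m n"
  let ?dc = "dc m n (op_ball m n R) (op_class m n G R) orc \<epsilon>"
  have d: "1 \<le> d" using size by (simp add: d_def)
  have goal: "ennreal (1 / 196608 * real d * K) \<le> ?dc"
    if "ennreal (real M / 48) \<le> ?dc" "real d * K \<le> 4096 * real M" for M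
    using that by (intro order_trans[OF ennreal_leI that(1)]) (simp add: mult.commute)
  have "ennreal (1 / 196608 * real d * K) \<le> ?dc"
  proof (cases "K < 4096")
    case True
    have "real d * K \<le> real d * 4096" using True by (intro mult_left_mono) auto
    then show ?thesis
      using dc_diagonal_lower_bound[OF local pos size K(1)] by (intro goal[of d]) (auto simp: d_def)
  next
    case False
    \<comment> \<open>Two sides up to \<open>\<kappa>\<close> give
      \<open>152 * 2 * \<kappa> \<le> 304 / 1024 * K < K\<close>, as random blocks require. From
      \<open>K \<ge> 4096\<close> follow \<open>\<kappa> \<ge> 4\<close> and
      \<open>K \<le> 2048 * \<kappa>\<close>.\<close>
    define \<kappa> where "\<kappa> = nat \<lfloor>K / 1024\<rfloor>"
    have "4 \<le> \<lfloor>K / 1024\<rfloor>" using False by (simp add: le_floor_iff)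
    then have \<kappa>: "4 \<le> \<kappa>" "real \<kappa> \<le> K / 1024" "K / 1024 < real \<kappa> + 1"
      unfolding \<kappa>_def by (auto simp: le_nat_iff; linarith)+
    have K2: "K \<le> 2048 * real \<kappa>" using \<kappa> by linarith
    have norm: "152 * real (a + b) < K" if "a \<le> \<kappa>" "b \<le> \<kappa>" for a b
    proof -
      have "real a \<le> real \<kappa>" "real b \<le> real \<kappa>" using that by simp_all
      then have "152 * real (a + b) \<le> 304 * real \<kappa>" by simp
      also have "\<dots> \<le> 304 * (K / 1024)" using \<kappa>(2) by simp
      also have "\<dots> < K" using False by simp
      finally show ?thesis .
    qed
    \<comment> \<open>Here the bound of \<open>K\<close> by \<open>max m n\<close> enters: a block
      of side \<open>\<kappa>\<close> fits into the longer dimension.\<close>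
    have "real \<kappa> < real (max m n)" using \<kappa> K False by (simp add: K_def)
    then have \<kappa>max: "\<kappa> \<le> max m n" by linarith
    show ?thesis
    proof (cases "\<kappa> \<le> d")
      case True
      \<comment> \<open>Rounding \<open>d / \<kappa>\<close> down loses at most a factor 2, as
        \<open>q \<ge> 1\<close>.\<close>
      define q where "q = d div \<kappa>"
      have q: "0 < q" "q * \<kappa> \<le> d" using True \<kappa> by (auto simp: q_def div_greater_zero_iff)
      have "d \<le> 2 * (q * \<kappa>)"
      proof -
        have "d < \<kappa> + \<kappa> * q" unfolding q_def using dividend_less_times_div[of \<kappa> d] \<kappa> by simp
        moreover have "\<kappa> * 1 \<le> \<kappa> * q" using q by (intro mult_left_mono) auto
        ultimately show ?thesis unfolding mult.commute[of q \<kappa>] by linarith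
      qed
      then have "real d \<le> real (2 * (q * \<kappa>))" by (simp only: of_nat_le_iff)
      then have "real d * K \<le> real (2 * (q * \<kappa>)) * (2048 * real \<kappa>)"
        using K2 False by (intro mult_mono) auto
      then have le: "real d * K \<le> 4096 * real (q * \<kappa> * \<kappa>)" by (simp add: mult_ac)
      have "2 * 2 \<le> \<kappa> * \<kappa>" using \<kappa> by (intro mult_mono) auto
      then have "ennreal (real (q * \<kappa> * \<kappa>) / 48) \<le> ?dc"
        using q norm[of \<kappa> \<kappa>] by (intro dc_random_block_lower_bound local pos) (auto simp: d_def K_def)
      then show ?thesis using le by (rule goal)
    next
      case False
      have le: "real d * K \<le> 4096 * real (d * \<kappa>)"
      proof -
        have "real d * K \<le> real d * (4096 * real \<kappa>)" using K2 by (intro mult_left_mono) auto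
        then show ?thesis by simp
      qed
      have d\<kappa>: "1 * 4 \<le> d * \<kappa>" using d \<kappa> by (intro mult_mono) auto
      have "ennreal (real (d * \<kappa>) / 48) \<le> ?dc"
      proof (cases "m \<le> n")
        case True
        then have "d = m" by (simp add: d_def)
        have "ennreal (real (1 * d * \<kappa>) / 48) \<le> ?dc"
          using norm[of d \<kappa>] False \<kappa>max True d\<kappa> \<open>d = m\<close>
          by (intro dc_random_block_lower_bound local pos) (auto simp: K_def)
        then show ?thesis by simp
      next
        case c: False
        then have "d = n" by (simp add: d_def)
        have "ennreal (real (1 * \<kappa> * d) / 48) \<le> ?dc"
          using norm[of \<kappa> d] False \<kappa>max c d\<kappa> \<open>d = n\<close>
          by (intro dc_random_block_lower_bound local pos) (auto simp: K_def mult.commute)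
        then show ?thesis by (simp add: mult.commute)
      qed
      then show ?thesis using le by (rule goal)
    qed
  qed
  then show ?thesis by (simp add: d_def K_def)
qed

theorem theorem3p6:
  shows "\<exists>c C :: real. 0 < c \<and> 0 < C \<and>
    (\<forall>(m::nat) (n::nat) (G::real) (R::real) (\<epsilon>::real) (orc::oracle_map).
       1 \<le> m \<longrightarrow> 1 \<le> n \<longrightarrow> 0 < G \<longrightarrow> 0 < R \<longrightarrow> 0 < \<epsilon> \<longrightarrow>
       real (max m n) > (G * R / \<epsilon>)\<^sup>2 \<longrightarrow> (G * R / \<epsilon>)\<^sup>2 > 1 \<longrightarrow>
       first_order_oracle m n (op_class m n G R) orc \<longrightarrow>
       local_oracle m n (op_class m n G R) orc \<longrightarrow>
       ennreal (c * real (min m n) * (G * R / \<epsilon>)\<^sup>2)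
         \<le> dc m n (op_ball m n R) (op_class m n G R) orc \<epsilon> \<and>
       dc m n (op_ball m n R) (op_class m n G R) orc \<epsilon>
         \<le> wcc m n (op_ball m n R) (op_class m n G R) orc \<epsilon> \<and>
       wcc m n (op_ball m n R) (op_class m n G R) orc \<epsilon>
         \<le> ennreal (C * real (min m n) * (G * R / \<epsilon>)\<^sup>2))"
proof (intro exI conjI allI impI)
  fix m n :: nat and G R \<epsilon> :: real and orc :: oracle_map
  assume size: "1 \<le> m" "1 \<le> n" and pos: "0 < G" "0 < R" "0 < \<epsilon>"
    and K: "(G * R / \<epsilon>)\<^sup>2 < real (max m n)" "1 < (G * R / \<epsilon>)\<^sup>2"
    and orc: "first_order_oracle m n (op_class m n G R) orc"
    and local: "local_oracle m n (op_class m n G R) orc"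
  show "ennreal (1 / 196608 * real (min m n) * (G * R / \<epsilon>)\<^sup>2)
      \<le> dc m n (op_ball m n R) (op_class m n G R) orc \<epsilon>"
    by (rule dc_op_norm_lower_bound[OF local pos size K(2,1)])
  show "dc m n (op_ball m n R) (op_class m n G R) orc \<epsilon>
      \<le> wcc m n (op_ball m n R) (op_class m n G R) orc \<epsilon>"
    by (rule dc_le_wcc)
  define k where "k = real (min m n) * (G * R / \<epsilon>)\<^sup>2"
  define T where "T = nat \<lceil>2 * k\<rceil>"
  \<comment> \<open>\<open>k \<ge> 1\<close> absorbs the rounding in \<open>T\<close>:
    \<open>\<lceil>2 * k\<rceil> \<le> 2 * k + 1 \<le> 3 * k\<close>, whence the constant 3.\<close>
  have "1 * 1 \<le> k" unfolding k_def using size K by (intro mult_mono) auto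
  then have T: "2 * k \<le> real T" "0 < T" "real T \<le> 3 * k" unfolding T_def by linarith+
  have "wcc m n (op_ball m n R) (op_class m n G R) orc \<epsilon> \<le> of_nat T"
    using T by (intro wcc_upper_bound[OF orc pos]) (simp_all add: k_def mult.assoc)
  also have "\<dots> = ennreal (real T)" by (rule ennreal_of_nat_eq_real_of_nat)
  also have "\<dots> \<le> ennreal (3 * real (min m n) * (G * R / \<epsilon>)\<^sup>2)"
    using T by (intro ennreal_leI) (simp add: k_def mult.assoc)
  finally show "wcc m n (op_ball m n R) (op_class m n G R) orc \<epsilon>
      \<le> ennreal (3 * real (min m n) * (G * R / \<epsilon>)\<^sup>2)" .
qed simp_all

end
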